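(* Let $p$ be an odd prime, $S$ a finite $p$-group and $\mathcal{F}$ a saturated fusion system on $S$. Let $E$ be an $\mathcal{F}$-essential subgroup of $S$ of rank $2$. If $E$ is not $\mathcal{F}$-characteristic in $N_S(E)$ and $\Phi(E)\le Z(E)$, then $E$ is an $\mathcal{F}$-pearl.
   Context: Rank of a finite group: minimal size of a generating set. For $P\le S$, $\mathrm{Aut}_{\mathcal{F}}(P)=\mathrm{Hom}_{\mathcal{F}}(P,P)$, $\mathrm{Out}_{\mathcal{F}}(P)=\mathrm{Aut}_{\mathcal{F}}(P)/\mathrm{Inn}(P)$, $P^{\mathcal{F}}=\{P\alpha:\alpha\in\mathrm{Hom}_{\mathcal{F}}(P,S)\}$. $E\le S$ is $\mathcal{F}$-essential if $C_S(P)\le P$ and $|N_S(E)|\ge|N_S(P)|$ for all $P\in E^{\mathcal{F}}$, and $\mathrm{Out}_{\mathcal{F}}(E)$ has a strongly $p$-embedded subgroup. For $Q\le P\le S$, $Q$ is $\mathcal{F}$-characteristic in $P$ if $Q$ is normalized by $\mathrm{Aut}_{\mathcal{F}}(P)$. An $\mathcal{F}$-pearl is an $\mathcal{F}$-essential subgroup that is either elementary abelian of order $p^2$ or non-abelian of order $p^3$. *)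

theory Defs
  imports "HOL-Algebra.Group_Action" "HOL-Algebra.Generated_Groups" "HOL-Algebra.Coset"
    "HOL-Library.FuncSet" "HOL-Computational_Algebra.Primes"
begin

section \<open>Fusion systems on a finite group G (the carrier of G plays the role of S)\<close>

text \<open>Morphisms are maps that are extensional on their domain (undefined outside).
  Conjugation is written on the right: x^g = g^-1 x g.\<close>

definition conjm :: "('a,'b) monoid_scheme \<Rightarrow> 'a \<Rightarrow> 'a set \<Rightarrow> ('a \<Rightarrow> 'a)" where
  "conjm G g P = (\<lambda>x\<in>P. inv\<^bsub>G\<^esub> g \<otimes>\<^bsub>G\<^esub> x \<otimes>\<^bsub>G\<^esub> g)"

definition HomS :: "('a,'b) monoid_scheme \<Rightarrow> 'a set \<Rightarrow> 'a set \<Rightarrow> ('a \<Rightarrow> 'a) set" where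
  "HomS G P Q = {conjm G g P | g. g \<in> carrier G \<and>
                   (\<lambda>x. inv\<^bsub>G\<^esub> g \<otimes>\<^bsub>G\<^esub> x \<otimes>\<^bsub>G\<^esub> g) ` P \<subseteq> Q}"

definition Inn :: "('a,'b) monoid_scheme \<Rightarrow> 'a set \<Rightarrow> ('a \<Rightarrow> 'a) set" where
  "Inn G P = {conjm G g P | g. g \<in> P}"

definition inj_hom :: "('a,'b) monoid_scheme \<Rightarrow> 'a set \<Rightarrow> 'a set \<Rightarrow> ('a \<Rightarrow> 'a) \<Rightarrow> bool" where
  "inj_hom G P Q \<phi> \<longleftrightarrow> \<phi> \<in> hom (G\<lparr>carrier := P\<rparr>) (G\<lparr>carrier := Q\<rparr>) \<and> inj_on \<phi> P
      \<and> \<phi> \<in> extensional P"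

text \<open>A fusion system: a category whose objects are the subgroups of S, with
  Hom_S(P,Q) \<subseteq> Hom_F(P,Q) \<subseteq> Inj(P,Q), closed under composition, and such that every
  morphism is an F-isomorphism onto its image followed by an inclusion.
  F P Q is Hom_F(P,Q).\<close>
definition fusion_system :: "('a,'b) monoid_scheme \<Rightarrow> ('a set \<Rightarrow> 'a set \<Rightarrow> ('a \<Rightarrow> 'a) set) \<Rightarrow> bool" where
  "fusion_system G F \<longleftrightarrow>
     (\<forall>P Q. F P Q \<noteq> {} \<longrightarrow> subgroup P G \<and> subgroup Q G) \<and>
     (\<forall>P Q. subgroup P G \<and> subgroup Q G \<longrightarrow>
         HomS G P Q \<subseteq> F P Q \<and> (\<forall>\<phi>\<in>F P Q. inj_hom G P Q \<phi>)) \<and>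
     (\<forall>P Q R \<phi> \<psi>. \<phi> \<in> F P Q \<longrightarrow> \<psi> \<in> F Q R \<longrightarrow> compose P \<psi> \<phi> \<in> F P R) \<and>
     (\<forall>P Q \<phi>. \<phi> \<in> F P Q \<longrightarrow>
         \<phi> \<in> F P (\<phi> ` P) \<and> restrict (inv_into P \<phi>) (\<phi> ` P) \<in> F (\<phi> ` P) P)"

abbreviation AutF :: "('a set \<Rightarrow> 'a set \<Rightarrow> ('a \<Rightarrow> 'a) set) \<Rightarrow> 'a set \<Rightarrow> ('a \<Rightarrow> 'a) set" where
  "AutF F P \<equiv> F P P"

abbreviation AutS :: "('a,'b) monoid_scheme \<Rightarrow> 'a set \<Rightarrow> ('a \<Rightarrow> 'a) set" where
  "AutS G P \<equiv> HomS G P P"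

definition fclass :: "('a,'b) monoid_scheme \<Rightarrow> ('a set \<Rightarrow> 'a set \<Rightarrow> ('a \<Rightarrow> 'a) set) \<Rightarrow> 'a set \<Rightarrow> 'a set set" where
  "fclass G F P = {\<phi> ` P | \<phi>. \<phi> \<in> F P (carrier G)}"

definition centralizer :: "('a,'b) monoid_scheme \<Rightarrow> 'a set \<Rightarrow> 'a set" where
  "centralizer G P = {g \<in> carrier G. \<forall>x\<in>P. g \<otimes>\<^bsub>G\<^esub> x = x \<otimes>\<^bsub>G\<^esub> g}"

definition center_of :: "('a,'b) monoid_scheme \<Rightarrow> 'a set \<Rightarrow> 'a set" where
  "center_of G P = {x \<in> P. \<forall>y\<in>P. x \<otimes>\<^bsub>G\<^esub> y = y \<otimes>\<^bsub>G\<^esub> x}"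

definition fully_normalized where
  "fully_normalized G F P \<longleftrightarrow>
     (\<forall>Q\<in>fclass G F P. card (normalizer G Q) \<le> card (normalizer G P))"

definition fully_centralized where
  "fully_centralized G F P \<longleftrightarrow>
     (\<forall>Q\<in>fclass G F P. card (centralizer G Q) \<le> card (centralizer G P))"

definition Nphi :: "('a,'b) monoid_scheme \<Rightarrow> 'a set \<Rightarrow> ('a \<Rightarrow> 'a) \<Rightarrow> 'a set" where
  "Nphi G P \<phi> = {g \<in> normalizer G P.
      (\<lambda>x\<in>\<phi> ` P. \<phi> (inv\<^bsub>G\<^esub> g \<otimes>\<^bsub>G\<^esub> inv_into P \<phi> x \<otimes>\<^bsub>G\<^esub> g)) \<in> AutS G (\<phi> ` P)}"

text \<open>Saturation (Broto-Levi-Oliver / Aschbacher-Kessar-Oliver, Def. I.2.2):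
  (I) Sylow axiom, (II) extension axiom.\<close>
definition saturated :: "('a,'b) monoid_scheme \<Rightarrow> nat \<Rightarrow> ('a set \<Rightarrow> 'a set \<Rightarrow> ('a \<Rightarrow> 'a) set) \<Rightarrow> bool" where
  "saturated G p F \<longleftrightarrow> fusion_system G F \<and>
     (\<forall>P. subgroup P G \<and> fully_normalized G F P \<longrightarrow>
        fully_centralized G F P \<and>
        (\<exists>m. card (AutF F P) = card (AutS G P) * m \<and> \<not> p dvd m)) \<and>
     (\<forall>P \<phi>. subgroup P G \<and> \<phi> \<in> F P (carrier G) \<and> fully_centralized G F (\<phi> ` P) \<longrightarrow>
        (\<exists>\<psi>\<in>F (Nphi G P \<phi>) (carrier G). \<forall>x\<in>P. \<psi> x = \<phi> x))"

definition AutGrp :: "('a set \<Rightarrow> 'a set \<Rightarrow> ('a \<Rightarrow> 'a) set) \<Rightarrow> 'a set \<Rightarrow> ('a \<Rightarrow> 'a) monoid" where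
  "AutGrp F P = \<lparr>carrier = F P P, monoid.mult = (\<lambda>\<alpha> \<beta>. compose P \<beta> \<alpha>), monoid.one = restrict id P\<rparr>"

definition OutF where
  "OutF G F P = AutGrp F P Mod Inn G P"

definition strongly_p_embedded :: "('c,'d) monoid_scheme \<Rightarrow> nat \<Rightarrow> 'c set \<Rightarrow> bool" where
  "strongly_p_embedded H p M \<longleftrightarrow> subgroup M H \<and> M \<noteq> carrier H \<and> p dvd card M \<and>
     (\<forall>x\<in>carrier H - M. \<not> p dvd card (M \<inter> (x <#\<^bsub>H\<^esub> M #>\<^bsub>H\<^esub> inv\<^bsub>H\<^esub> x)))"

definition essential where
  "essential G p F E \<longleftrightarrow> subgroup E G \<and>
     (\<forall>P\<in>fclass G F E. centralizer G P \<subseteq> P \<and> card (normalizer G P) \<le> card (normalizer G E)) \<and>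
     (\<exists>M. strongly_p_embedded (OutF G F E) p M)"

definition fchar where
  "fchar F Q P \<longleftrightarrow> (\<forall>\<alpha>\<in>AutF F P. \<alpha> ` Q = Q)"

definition grp_rank :: "('a,'b) monoid_scheme \<Rightarrow> 'a set \<Rightarrow> nat" where
  "grp_rank G E = (LEAST n. \<exists>A. A \<subseteq> E \<and> finite A \<and> card A = n \<and> generate G A = E)"

definition frattini :: "('a,'b) monoid_scheme \<Rightarrow> 'a set \<Rightarrow> 'a set" where
  "frattini G E = E \<inter> \<Inter>{M. subgroup M G \<and> M \<subset> E \<and>
       (\<forall>N. subgroup N G \<and> M \<subseteq> N \<and> N \<subseteq> E \<longrightarrow> N = M \<or> N = E)}"

definition abelian_sub where
  "abelian_sub G E \<longleftrightarrow> (\<forall>x\<in>E. \<forall>y\<in>E. x \<otimes>\<^bsub>G\<^esub> y = y \<otimes>\<^bsub>G\<^esub> x)"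

definition pearl where
  "pearl G p F E \<longleftrightarrow> essential G p F E \<and>
     ((card E = p ^ 2 \<and> abelian_sub G E \<and> (\<forall>x\<in>E. x [^]\<^bsub>G\<^esub> p = \<one>\<^bsub>G\<^esub>)) \<or>
      (card E = p ^ 3 \<and> \<not> abelian_sub G E))"

end

theory Submission
  imports Defs "HOL-Algebra.Multiplicative_Group" "HOL-Algebra.Sylow"
begin

text \<open>Write D for the subgroup generated by p-th powers and commutators of E; it lies in
  \<open>\<Phi>(E)\<close>, so it consists of nongenerators and is central. Since E has rank 2, |E : D| = p^2, and it
  suffices to show that E has exponent p.

  Automorphisms in \<open>Aut\<^sub>F(E)\<close> stabilizing an invariant chain E > L > D form a normal p-subgroup, and
  a group with a strongly p-embedded subgroup has no nontrivial one, so they are inner. Let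
  \<open>E\<^sub>0 = E\<alpha> \<noteq> E\<close> with \<open>\<alpha> \<in> Aut\<^sub>F(N\<^sub>S(E))\<close>. Then \<open>L = E \<inter> E\<^sub>0\<close> has index p in both, contains D and
  \<open>D\<^sub>0 = D\<alpha>\<close>, and is not invariant under \<open>Aut\<^sub>F(E)\<close>; hence an invariant subgroup of E meeting
  \<open>L - D\<close> is all of E. This is applied to the subgroups of elements of order dividing p and \<open>p\<^sup>2\<close>
  (p odd and class 2 make the p-th power map a homomorphism), starting from \<open>y = [x, g] \<in> L - D\<close>
  with \<open>x \<in> E\<close>, \<open>g \<in> E\<^sub>0\<close>. If g centralizes D, then \<open>y\<^sup>p = [x\<^sup>p, g] = 1\<close>. Otherwise
  \<open>x\<^sup>p \<in> E\<^sub>0\<close>, so its p-th power lies in \<open>D\<^sub>0\<close> and commutes with g; thus E has exponent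
  dividing \<open>p\<^sup>2\<close>, D and \<open>D\<^sub>0\<close> have exponent p, and \<open>L = D D\<^sub>0\<close> again has exponent p.\<close>

section \<open>Finite p-groups\<close>

text \<open>On a finite closed set left multiplication by one of its elements is a permutation, so
  \<open>\<one>\<close> is hit and inverses come for free.\<close>

lemma (in group) subgroup_finite_closedI:
  assumes "H \<subseteq> carrier G" and "finite H" and "\<one> \<in> H"
    and closed: "\<And>x y. x \<in> H \<Longrightarrow> y \<in> H \<Longrightarrow> x \<otimes> y \<in> H"
  shows "subgroup H G"
proof (rule subgroupI)
  fix x assume x: "x \<in> H"
  then have inj: "inj_on (\<lambda>y. x \<otimes> y) H"
    using assms(1) by (intro inj_onI) (use x in \<open>simp add: subset_iff\<close>)
  have "(\<lambda>y. x \<otimes> y) ` H = H"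
    by (rule card_subset_eq[OF \<open>finite H\<close>]) (use closed x card_image[OF inj] in auto)
  then obtain y where "y \<in> H" "x \<otimes> y = \<one>"
    using assms(3) by (metis imageE)
  then show "inv x \<in> H"
    using x assms(1) by (metis inv_equality inv_inv subsetD)
qed (use assms in auto)

lemma (in group) card_subgroup_dvd:
  assumes "subgroup M G" "subgroup E G" "M \<subseteq> E" "finite E"
  shows "card M dvd card E"
proof -
  interpret E: group "G\<lparr>carrier := E\<rparr>" using assms by (simp add: subgroup_imp_group)
  have "subgroup M (G\<lparr>carrier := E\<rparr>)" using assms by (simp add: subgroup_incl)
  from E.lagrange[OF this] show ?thesis
    by (simp add: order_def) (metis dvd_triv_right)
qed

lemma (in group) card_rcosets_in_subgroup:
  assumes "subgroup M G" "subgroup E G" "M \<subseteq> E" "finite E"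
  shows "card ((\<lambda>x. M #> x) ` E) * card M = card E"
proof -
  interpret E: group "G\<lparr>carrier := E\<rparr>" using assms by (simp add: subgroup_imp_group)
  have "subgroup M (G\<lparr>carrier := E\<rparr>)" using assms by (simp add: subgroup_incl)
  moreover have "rcosets\<^bsub>G\<lparr>carrier := E\<rparr>\<^esub> M = (\<lambda>x. M #> x) ` E"
    by (auto simp: RCOSETS_def)
  ultimately show ?thesis using E.lagrange[of M]
    by (simp add: order_def)
qed

text \<open>An orbit that is not a single fixed point has order p^i with i > 0. The last assumption
  describes a right action, which suits right cosets, conjugation by \<open>inv g x g\<close> and
  the left-to-right product in \<open>AutGrp\<close>.\<close>

lemma (in group) fixed_points_cong:
  assumes "prime p" "order G = p ^ n" "finite X"
    and act_closed: "\<And>g x. g \<in> carrier G \<Longrightarrow> x \<in> X \<Longrightarrow> act g x \<in> X"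
    and act_one: "\<And>x. x \<in> X \<Longrightarrow> act \<one> x = x"
    and act_mult: "\<And>g h x. g \<in> carrier G \<Longrightarrow> h \<in> carrier G \<Longrightarrow> x \<in> X \<Longrightarrow>
      act (g \<otimes> h) x = act h (act g x)"
  shows "card X mod p = card {x \<in> X. \<forall>g\<in>carrier G. act g x = x} mod p"
proof -
  \<comment> \<open>Inverting g turns the right action into the left action that
    \<open>group_action\<close> expects.\<close>
  define \<phi> where "\<phi> g = (\<lambda>x\<in>X. act (inv g) x)" for g
  have bij: "\<phi> g \<in> Bij X" if "g \<in> carrier G" for g
  proof -
    have "bij_betw (\<lambda>x. act (inv g) x) X X"
      by (rule bij_betw_byWitness[where f' = "act g"])
        (use that in \<open>auto simp: act_closed act_one simp flip: act_mult\<close>)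
    then show ?thesis
      by (simp add: Bij_def \<phi>_def cong: bij_betw_cong)
  qed
  have hom: "\<phi> \<in> hom G (BijGroup X)"
  proof (rule homI)
    fix g h assume gh: "g \<in> carrier G" "h \<in> carrier G"
    have "\<phi> (g \<otimes> h) = compose X (\<phi> g) (\<phi> h)"
      by (rule ext) (use gh in \<open>auto simp: \<phi>_def compose_def act_closed act_mult inv_mult_group\<close>)
    then show "\<phi> (g \<otimes> h) = \<phi> g \<otimes>\<^bsub>BijGroup X\<^esub> \<phi> h"
      using gh bij by (simp add: BijGroup_def)
  qed (use bij in \<open>simp add: BijGroup_def\<close>)
  interpret group_action G X \<phi>
    by (simp add: group_action_def group_hom_def group_hom_axioms_def group_BijGroup hom is_group)
  define Fix where "Fix = {x \<in> X. \<forall>g\<in>carrier G. act g x = x}"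
  have orbit_refl': "x \<in> orbit G \<phi> x" if "x \<in> X" for x
    using orbit_refl that by blast
  have orb_sub: "orbit G \<phi> x \<subseteq> X" if "x \<in> X" for x
    using that element_image unfolding orbit_def by blast
  have fixI: "x \<in> Fix" if x: "x \<in> X" and "orbit G \<phi> x = {x}" for x
  proof -
    have "act g x = x" if "g \<in> carrier G" for g
    proof -
      have "\<phi> (inv g) x \<in> orbit G \<phi> x" using that unfolding orbit_def by blast
      then show ?thesis using \<open>orbit G \<phi> x = {x}\<close> x that by (simp add: \<phi>_def)
    qed
    then show ?thesis using x by (simp add: Fix_def)
  qed
  have fixD: "orbit G \<phi> x = {x}" if x: "x \<in> Fix" for x
    using x by (auto simp: Fix_def orbit_def \<phi>_def intro!: exI[of _ \<one>])
  \<comment> \<open>The nontrivial orbits: they partition \<open>X - Fix\<close>, and each has order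
    divisible by p.\<close>
  define C where "C = orbit G \<phi> ` (X - Fix)"
  have UC: "\<Union>C = X - Fix"
  proof
    show "\<Union>C \<subseteq> X - Fix"
    proof
      fix y assume "y \<in> \<Union>C"
      then obtain x where x: "x \<in> X" "x \<notin> Fix" "y \<in> orbit G \<phi> x" by (auto simp: C_def)
      then have y: "y \<in> X" using orb_sub by blast
      have "x \<in> orbit G \<phi> y" using orbit_sym x y by blast
      then have "y \<in> Fix \<Longrightarrow> x = y" using fixD by blast
      then show "y \<in> X - Fix" using x y by blast
    qed
    show "X - Fix \<subseteq> \<Union>C" using orbit_refl' by (auto simp: C_def)
  qed
  have "p dvd card (\<Union>C)"
  proof (rule dvd_partition)
    show "finite (\<Union>C)" using UC assms by simp
    show "\<forall>c\<in>C. p dvd card c"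
    proof
      fix c assume "c \<in> C"
      then obtain x where x: "x \<in> X" "x \<notin> Fix" "c = orbit G \<phi> x" by (auto simp: C_def)
      have "card c dvd p ^ n" using orbit_stabilizer_theorem[OF x(1)] x(3) assms(2)
        by (metis dvd_triv_left)
      then obtain i where i: "card c = p ^ i"
        using divides_primepow_nat[OF assms(1)] by blast
      have "card c \<noteq> 1"
      proof
        assume "card c = 1"
        then obtain y where "c = {y}" using card_1_singletonE by blast
        then have "c = {x}" using orbit_refl'[OF x(1)] x(3) by auto
        then show False using fixI x by auto
      qed
      then have "i \<noteq> 0" using i by auto
      then show "p dvd card c" using i by auto
    qed
    show "\<forall>c1\<in>C. \<forall>c2\<in>C. c1 \<noteq> c2 \<longrightarrow> c1 \<inter> c2 = {}"
      using disjoint_union unfolding C_def orbits_def by blast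
  qed
  moreover have "card X = card Fix + card (X - Fix)"
  proof -
    have "Fix \<subseteq> X" by (auto simp: Fix_def)
    then show ?thesis using assms(3) by (metis add.commute card_mono card_Diff_subset finite_subset le_add_diff_inverse)
  qed
  ultimately show ?thesis unfolding UC Fix_def[symmetric]
    by (auto elim!: dvdE)
qed

text \<open>The number of fixed points is divisible by p and \<open>x0\<close> is one of them, so
  there is a second one.\<close>

lemma (in group) fixed_point_exists:
  assumes "prime p" "order G = p ^ n" "finite X" "p dvd card X" "x0 \<in> X"
    and "\<And>g. g \<in> carrier G \<Longrightarrow> act g x0 = x0"
    and "\<And>g x. g \<in> carrier G \<Longrightarrow> x \<in> X \<Longrightarrow> act g x \<in> X"
    and "\<And>x. x \<in> X \<Longrightarrow> act \<one> x = x"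
    and "\<And>g h x. g \<in> carrier G \<Longrightarrow> h \<in> carrier G \<Longrightarrow> x \<in> X \<Longrightarrow>
      act (g \<otimes> h) x = act h (act g x)"
  obtains x where "x \<in> X" "x \<noteq> x0" "\<And>g. g \<in> carrier G \<Longrightarrow> act g x = x"
proof -
  let ?F = "{x \<in> X. \<forall>g\<in>carrier G. act g x = x}"
  have "card X mod p = card ?F mod p"
    by (rule fixed_points_cong) (use assms in auto)
  then have "p dvd card ?F" using assms(4) by (simp add: dvd_eq_mod_eq_0)
  moreover have "1 < p" using assms(1) prime_gt_1_nat by blast
  ultimately have "?F \<noteq> {x0}" by auto
  moreover have "x0 \<in> ?F" using assms by auto
  ultimately show ?thesis using that by blast
qed

text \<open>M acts by right multiplication on its cosets in E, whose number is a positive power of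
  p. The coset M is fixed, hence so is another coset \<open>M #> z\<close>, and this means that z
  conjugates M into itself.\<close>

lemma (in group) normalizer_grows:
  assumes "prime p" "subgroup M G" "subgroup E G" "M \<subset> E" "card E = p ^ n"
  obtains z where "z \<in> E" "z \<notin> M" "\<And>m. m \<in> M \<Longrightarrow> z \<otimes> m \<otimes> inv z \<in> M"
proof -
  interpret H: group "G\<lparr>carrier := M\<rparr>" using assms by (simp add: subgroup_imp_group)
  have finE: "finite E" using assms prime_gt_0_nat by (intro card_ge_0_finite) simp
  have MG: "M \<subseteq> carrier G" "E \<subseteq> carrier G" using assms subgroup.subset by blast+
  let ?X = "(\<lambda>x. M #> x) ` E"
  have c: "card ?X * card M = p ^ n"
    using card_rcosets_in_subgroup[of M E] assms finE by auto
  have "card M dvd p ^ n" using c by (metis dvd_triv_right)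
  then obtain k where k: "card M = p ^ k" using divides_primepow_nat assms(1) by blast
  have "card ?X dvd p ^ n" using c by (metis dvd_triv_left)
  then obtain i where i: "card ?X = p ^ i" using divides_primepow_nat assms(1) by blast
  have "card M < card E" using assms(4) finE by (simp add: psubset_card_mono)
  then have "i \<noteq> 0" using c i assms(5) by (cases i) auto
  then have "p dvd card ?X" using i by simp
  have MX: "M \<in> ?X"
    using subgroup.one_closed[OF assms(3)] MG coset_mult_one[OF MG(1)] by (metis image_eqI)
  obtain C where C: "C \<in> ?X" "C \<noteq> M" "\<And>g. g \<in> M \<Longrightarrow> C #> g = C"
  proof (rule H.fixed_point_exists[of p k ?X M "\<lambda>g C. C #> g"])
    show "order (G\<lparr>carrier := M\<rparr>) = p ^ k" using k by (simp add: order_def)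
    show "\<And>g. g \<in> carrier (G\<lparr>carrier := M\<rparr>) \<Longrightarrow> M #> g = M"
      using assms coset_join2 MG by auto
    show "\<And>g x. g \<in> carrier (G\<lparr>carrier := M\<rparr>) \<Longrightarrow> x \<in> ?X \<Longrightarrow> x #> g \<in> ?X"
      using MG assms by (auto simp: coset_mult_assoc subset_iff subgroup.m_closed psubset_eq)
    show "\<And>x. x \<in> ?X \<Longrightarrow> x #> \<one>\<^bsub>G\<lparr>carrier := M\<rparr>\<^esub> = x"
      using MG by (auto simp: coset_mult_assoc subset_iff)
    show "\<And>g h x. g \<in> carrier (G\<lparr>carrier := M\<rparr>) \<Longrightarrow> h \<in> carrier (G\<lparr>carrier := M\<rparr>) \<Longrightarrow> x \<in> ?X \<Longrightarrow>
           x #> g \<otimes>\<^bsub>G\<lparr>carrier := M\<rparr>\<^esub> h = x #> g #> h"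
      using MG by (auto simp: coset_mult_assoc m_assoc subset_iff)
  qed (use assms finE MX \<open>p dvd card ?X\<close> in auto)
  then obtain z where z: "z \<in> E" "C = M #> z" by auto
  have zG: "z \<in> carrier G" using z MG by auto
  show ?thesis
  proof
    show "z \<in> E" by fact
    show "z \<notin> M" using C(2) z coset_join2[OF zG assms(2)] by auto
    fix m assume m: "m \<in> M"
    have "M #> (z \<otimes> m) = M #> z"
      using C(3)[OF m] z m MG zG by (simp add: coset_mult_assoc subset_iff)
    then have "z \<otimes> m \<in> M #> z"
      using rcos_self[of "z \<otimes> m" M] assms m MG zG by auto
    then show "z \<otimes> m \<otimes> inv z \<in> M"
      using subgroup.rcos_module_imp[OF assms(2) is_group zG] by simp
  qed
qed

text \<open>An element x other than \<open>\<one>\<close> generates the group by Lagrange, so y is a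
  power of x.\<close>

lemma (in group) prime_order_comm:
  assumes "prime (order G)" "x \<in> carrier G" "y \<in> carrier G"
  shows "x \<otimes> y = y \<otimes> x"
proof (cases "x = \<one>")
  case False
  have fin: "finite (carrier G)"
    using assms(1) by (metis card.infinite not_prime_0 order_def)
  have sub: "subgroup (generate G {x}) G" using assms by (simp add: generate_is_subgroup)
  have "card (generate G {x}) dvd order G"
    using card_subgroup_dvd[OF sub subgroup_self _ fin] sub subgroup.subset by (auto simp: order_def)
  moreover have "card (generate G {x}) \<noteq> 1"
  proof
    assume "card (generate G {x}) = 1"
    moreover have "x \<in> generate G {x}" "\<one> \<in> generate G {x}"
      by (auto intro: generate.incl generate.one)
    ultimately show False using False by (metis card_1_singletonE singletonD)
  qed
  ultimately have "card (generate G {x}) = order G"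
    using assms(1) by (metis One_nat_def prime_nat_iff)
  then have "generate G {x} = carrier G"
    using card_subset_eq[OF fin] sub subgroup.subset by (auto simp: order_def)
  then obtain k :: int where "y = x [^] k"
    using assms generate_pow[of x] by auto
  then show ?thesis using assms(2)
    by (simp add: int_pow_mult[of x 1 k, simplified, symmetric]
        int_pow_mult[of x k 1, simplified, symmetric] add.commute)
qed (use assms in auto)

text \<open>The quotient has order p, hence is abelian of exponent p.\<close>

lemma (in normal) prime_index_pow_commutator:
  assumes "finite (carrier G)" "prime p" "order G = p * card H" "x \<in> carrier G" "y \<in> carrier G"
  shows "x [^] p \<in> H" and "x \<otimes> y \<otimes> inv x \<otimes> inv y \<in> H"
proof -
  interpret Q: group "G Mod H" by (rule factorgroup_is_group)
  have "card (rcosets H) * card H = order G" using lagrange subgroup_axioms by blast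
  moreover have "0 < card H" using assms(1) finite_imp_card_positive by blast
  ultimately have ord: "order (G Mod H) = p"
    using assms(3) by (auto simp: order_def FactGroup_def)
  have xy: "H #> x \<in> carrier (G Mod H)" "H #> y \<in> carrier (G Mod H)"
    using assms by (auto simp: carrier_FactGroup)
  have "(H #> x) [^]\<^bsub>G Mod H\<^esub> p = \<one>\<^bsub>G Mod H\<^esub>"
    using Q.pow_order_eq_1[OF xy(1)] ord by simp
  then have "H #> (x [^] p) = H" using FactGroup_pow[OF assms(4)] by simp
  then show "x [^] p \<in> H" using coset_join1[of H "x [^] p"] assms subgroup_axioms by auto
  have "(H #> x) \<otimes>\<^bsub>G Mod H\<^esub> (H #> y) = (H #> y) \<otimes>\<^bsub>G Mod H\<^esub> (H #> x)"
    using Q.prime_order_comm[OF _ xy] ord assms by simp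
  then have "H #> (x \<otimes> y) = H #> (y \<otimes> x)" using assms by (simp add: rcos_sum)
  then have "x \<otimes> y \<in> H #> (y \<otimes> x)"
    using rcos_self[of "x \<otimes> y" H] assms subgroup_axioms by auto
  then have "x \<otimes> y \<otimes> inv (y \<otimes> x) \<in> H"
    using rcos_module_imp[OF is_group, of "y \<otimes> x"] assms by simp
  then show "x \<otimes> y \<otimes> inv x \<otimes> inv y \<in> H" using assms by (simp add: inv_mult_group m_assoc)
qed

lemma p_group_subgroup_card:
  assumes "group G" "prime (p::nat)" "subgroup M G" "subgroup E G" "M \<subseteq> E" "card E = p ^ n"
  obtains k where "card M = p ^ k"
proof -
  have "finite E" using assms prime_gt_0_nat by (intro card_ge_0_finite) simp
  then have "card M dvd p ^ n" using group.card_subgroup_dvd[of G M E] assms by simp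
  then show ?thesis using that divides_primepow_nat assms(2) by blast
qed

text \<open>The prime p factors as |E : K| |K : D|. The dichotomies below for subgroups between
  neighbours of a chain with steps of index p rest on this.\<close>

lemma (in group) subgroup_between_prime_index:
  assumes "subgroup D G" "subgroup K G" "subgroup E G" "D \<subseteq> K" "K \<subseteq> E" "finite E"
    and "prime p" "card E = p * card D"
  shows "K = D \<or> K = E"
proof -
  have fin: "finite K" using assms finite_subset by blast
  obtain a where a: "card K = card D * a"
    using card_subgroup_dvd[of D K] assms fin dvdE by blast
  obtain b where b: "card E = card K * b"
    using card_subgroup_dvd[of K E] assms fin dvdE by blast
  have "0 < card D"
    using assms fin subgroup.one_closed[of D G] by (metis card_gt_0_iff empty_iff finite_subset)
  then have "p = a * b" using a b assms(8) by auto
  then have "a = 1 \<or> b = 1" using assms(7) by (metis prime_product)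
  then show ?thesis
  proof
    assume "a = 1"
    then have "D = K" using a fin assms(4) by (intro card_subset_eq) simp_all
    then show ?thesis by simp
  next
    assume "b = 1"
    then have "K = E" using b assms(5,6) by (intro card_subset_eq) simp_all
    then show ?thesis by simp
  qed
qed

lemma (in group) index_p_pow_commutator:
  assumes "subgroup M G" "subgroup E G" "M \<subseteq> E" "finite E" "prime p" "card E = p * card M"
    and nrm: "\<And>x m. x \<in> E \<Longrightarrow> m \<in> M \<Longrightarrow> x \<otimes> m \<otimes> inv x \<in> M"
    and xy: "x \<in> E" "y \<in> E"
  shows "x [^] p \<in> M" and "x \<otimes> y \<otimes> inv x \<otimes> inv y \<in> M"
proof -
  interpret E: group "G\<lparr>carrier := E\<rparr>" using assms by (simp add: subgroup_imp_group)
  interpret M: normal M "G\<lparr>carrier := E\<rparr>"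
    using assms by (auto simp: E.normal_inv_iff subgroup_incl)
  show "x [^] p \<in> M" and "x \<otimes> y \<otimes> inv x \<otimes> inv y \<in> M"
    using M.prime_index_pow_commutator[of p x y] assms
    by (auto simp: order_def simp flip: nat_pow_consistent)
qed

section \<open>Maximal subgroups of finite p-groups\<close>

definition maximal_subgroup :: "('a,'b) monoid_scheme \<Rightarrow> 'a set \<Rightarrow> 'a set \<Rightarrow> bool" where
  "maximal_subgroup G M E \<longleftrightarrow> subgroup M G \<and> M \<subset> E \<and>
       (\<forall>N. subgroup N G \<and> M \<subseteq> N \<and> N \<subseteq> E \<longrightarrow> N = M \<or> N = E)"

text \<open>The elements of E that conjugate M into itself form a subgroup. It is strictly larger
  than M by \<open>normalizer_grows\<close>, so by maximality it is E.\<close>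

lemma (in group) maximal_subgroup_normal:
  assumes "prime p" "subgroup E G" "card E = p ^ n" "maximal_subgroup G M E"
    and "x \<in> E" "m \<in> M"
  shows "x \<otimes> m \<otimes> inv x \<in> M"
proof -
  have M: "subgroup M G" "M \<subset> E" using assms by (auto simp: maximal_subgroup_def)
  have fin: "finite E" using assms prime_gt_0_nat by (intro card_ge_0_finite) simp
  have EG: "E \<subseteq> carrier G" using assms subgroup.subset by blast
  let ?N = "{z \<in> E. \<forall>m\<in>M. z \<otimes> m \<otimes> inv z \<in> M}"
  have "subgroup ?N G"
  proof (rule subgroup_finite_closedI)
    fix a b assume ab: "a \<in> ?N" "b \<in> ?N"
    have "a \<otimes> b \<otimes> m \<otimes> inv (a \<otimes> b) = a \<otimes> (b \<otimes> m \<otimes> inv b) \<otimes> inv a" if "m \<in> M" for m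
      using ab that M EG by (auto simp: m_assoc inv_mult_group subset_iff psubset_eq)
    then show "a \<otimes> b \<in> ?N" using ab assms by (auto simp: subgroup.m_closed)
  next
    show "\<one> \<in> ?N" using assms M EG by (auto simp: subgroup.one_closed subset_iff psubset_eq)
  qed (use EG fin in auto)
  moreover have "M \<subseteq> ?N" using M by (auto simp: subgroup.m_closed subgroup.m_inv_closed)
  moreover obtain z where "z \<in> E" "z \<notin> M" "\<And>m. m \<in> M \<Longrightarrow> z \<otimes> m \<otimes> inv z \<in> M"
    using normalizer_grows[OF assms(1) M(1) assms(2) M(2) assms(3)] by blast
  ultimately have "?N = E" using assms(4) unfolding maximal_subgroup_def by blast
  then show ?thesis using assms by blast
qed

text \<open>A subgroup R of order p of the nontrivial p-group E/M pulls back to a subgroup between M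
  and E other than M. By maximality this is E, so R is all of E/M.\<close>

lemma (in group) maximal_subgroup_card:
  assumes "prime p" "subgroup E G" "card E = p ^ n" "maximal_subgroup G M E"
  shows "card E = p * card M"
proof -
  have M: "subgroup M G" "M \<subset> E" using assms by (auto simp: maximal_subgroup_def)
  have fin: "finite E" using assms prime_gt_0_nat by (intro card_ge_0_finite) simp
  have EG: "E \<subseteq> carrier G" "M \<subseteq> carrier G" using assms M subgroup.subset by blast+
  interpret E: group "G\<lparr>carrier := E\<rparr>" using assms by (simp add: subgroup_imp_group)
  have "M \<lhd> G\<lparr>carrier := E\<rparr>"
    using assms M maximal_subgroup_normal[OF assms] by (auto simp: E.normal_inv_iff subgroup_incl)
  then interpret M: normal M "G\<lparr>carrier := E\<rparr>" .
  let ?Q = "G\<lparr>carrier := E\<rparr> Mod M"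
  interpret Q: group ?Q by (rule M.factorgroup_is_group)
  have carrierQ: "carrier ?Q = (\<lambda>x. M #> x) ` E" by (simp add: carrier_FactGroup)
  have c: "order ?Q * card M = p ^ n"
    using card_rcosets_in_subgroup[of M E] assms M fin by (auto simp: order_def carrierQ)
  then have "order ?Q dvd p ^ n" by (metis dvd_triv_left)
  then obtain i where i: "order ?Q = p ^ i" using divides_primepow_nat assms(1) by blast
  have "card M < card E" using M fin by (simp add: psubset_card_mono)
  then obtain j where j: "i = Suc j" using c i assms(3) by (cases i) auto
  \<comment> \<open>Cauchy's theorem, as the case of exponent 1 of \<open>sylow_thm\<close>.\<close>
  obtain R where R: "subgroup R ?Q" "card R = p"
    using sylow_thm[OF assms(1) Q.is_group, of 1 "p ^ j"] i j fin by (auto simp: carrierQ)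
  let ?N = "{x \<in> E. M #> x \<in> R}"
  have hom: "M #> (a \<otimes> b) = (M #> a) \<otimes>\<^bsub>?Q\<^esub> (M #> b)" if "a \<in> E" "b \<in> E" for a b
    using M.rcos_sum[of a b] that by simp
  have MR: "M \<in> R" using subgroup.one_closed[OF R(1)] by simp
  have "subgroup ?N G"
  proof (rule subgroup_finite_closedI)
    show "\<one> \<in> ?N" using assms MR EG by (auto simp: subgroup.one_closed)
    fix a b assume "a \<in> ?N" "b \<in> ?N"
    then show "a \<otimes> b \<in> ?N"
      using assms hom subgroup.m_closed[OF R(1)] by (auto simp: subgroup.m_closed)
  qed (use EG fin in auto)
  moreover have "M \<subseteq> ?N"
    using MR M EG coset_join2[of _ M] by auto
  ultimately have N: "?N = M \<or> ?N = E" using assms(4) unfolding maximal_subgroup_def by blast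
  have Rsub: "R \<subseteq> (\<lambda>x. M #> x) ` E" using subgroup.subset[OF R(1)] carrierQ by simp
  have "?N \<noteq> M"
  proof
    assume NM: "?N = M"
    have "C = M" if C: "C \<in> R" for C
    proof -
      obtain x where x: "x \<in> E" "C = M #> x" using C Rsub by blast
      then have "x \<in> M" using C NM by blast
      then show ?thesis using x EG coset_join2[OF _ M(1)] by blast
    qed
    then have "R \<subseteq> {M}" by blast
    then have "card R \<le> 1" using card_mono[of "{M}" R] by simp
    then show False using R prime_gt_1_nat[OF assms(1)] by simp
  qed
  with N have "?N = E" by blast
  then have "(\<lambda>x. M #> x) ` E \<subseteq> R" by blast
  then have "R = carrier ?Q" using Rsub carrierQ by (intro equalityI) simp_all
  then have "order ?Q = p" using R by (simp add: order_def)
  then show ?thesis using c assms(3) by simp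
qed

lemma (in group) maximal_subgroup_exists:
  assumes "subgroup K G" "subgroup E G" "K \<subset> E" "finite E"
  obtains M where "maximal_subgroup G M E" "K \<subseteq> M"
proof -
  let ?S = "{M. subgroup M G \<and> K \<subseteq> M \<and> M \<subset> E}"
  have "finite ?S" by (rule finite_subset[of _ "Pow E"]) (use assms in auto)
  moreover have "K \<in> ?S" using assms by auto
  ultimately obtain M where M: "M \<in> ?S" "\<And>N. N \<in> ?S \<Longrightarrow> M \<subseteq> N \<Longrightarrow> N = M"
    by (metis (no_types, lifting) finite_has_maximal2)
  then have "maximal_subgroup G M E" unfolding maximal_subgroup_def by blast
  then show ?thesis using that M by blast
qed

section \<open>The subgroup generated by p-th powers and commutators\<close>

text \<open>For a finite p-group this is the Frattini subgroup; only the inclusion is needed.\<close>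

definition pfrat :: "('a,'b) monoid_scheme \<Rightarrow> nat \<Rightarrow> 'a set \<Rightarrow> 'a set" where
  "pfrat G p E = generate G ({x [^]\<^bsub>G\<^esub> p | x. x \<in> E} \<union>
     {x \<otimes>\<^bsub>G\<^esub> y \<otimes>\<^bsub>G\<^esub> inv\<^bsub>G\<^esub> x \<otimes>\<^bsub>G\<^esub> inv\<^bsub>G\<^esub> y | x y. x \<in> E \<and> y \<in> E})"

lemma pfrat_pow: "x \<in> E \<Longrightarrow> x [^]\<^bsub>G\<^esub> p \<in> pfrat G p E"
  unfolding pfrat_def by (rule generate.incl) auto

lemma pfrat_commutator:
  "x \<in> E \<Longrightarrow> y \<in> E \<Longrightarrow> x \<otimes>\<^bsub>G\<^esub> y \<otimes>\<^bsub>G\<^esub> inv\<^bsub>G\<^esub> x \<otimes>\<^bsub>G\<^esub> inv\<^bsub>G\<^esub> y \<in> pfrat G p E"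
  unfolding pfrat_def by (rule generate.incl) auto

context group
begin

lemma pfrat_leI:
  assumes "subgroup M G" "\<And>x. x \<in> E \<Longrightarrow> x [^] p \<in> M"
    and "\<And>x y. x \<in> E \<Longrightarrow> y \<in> E \<Longrightarrow> x \<otimes> y \<otimes> inv x \<otimes> inv y \<in> M"
  shows "pfrat G p E \<subseteq> M"
  unfolding pfrat_def by (rule generate_subgroup_incl) (use assms in auto)

lemma subgroup_nat_pow_closed:
  assumes "subgroup H G" "x \<in> H" shows "x [^] (n::nat) \<in> H"
  using assms by (induction n) (auto simp: subgroup.one_closed subgroup.m_closed)

lemma pfrat_subset: "subgroup E G \<Longrightarrow> pfrat G p E \<subseteq> E"
  by (rule pfrat_leI)
    (auto simp: subgroup_nat_pow_closed subgroup.m_closed subgroup.m_inv_closed)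

lemma subgroup_pfrat: "subgroup E G \<Longrightarrow> subgroup (pfrat G p E) G"
  unfolding pfrat_def using subgroup.subset[of E G]
  by (intro generate_is_subgroup) auto

lemma pfrat_le_maximal:
  assumes "prime p" "subgroup E G" "card E = p ^ n" "maximal_subgroup G M E"
  shows "pfrat G p E \<subseteq> M"
proof -
  have fin: "finite E" using assms prime_gt_0_nat by (intro card_ge_0_finite) simp
  have M: "subgroup M G" "M \<subset> E" using assms by (auto simp: maximal_subgroup_def)
  note index_p_pow_commutator[OF M(1) assms(2) _ fin assms(1) maximal_subgroup_card[OF assms]
      maximal_subgroup_normal[OF assms]]
  then show ?thesis using M by (intro pfrat_leI) auto
qed

text \<open>\<open>maximal_subgroup\<close> is the condition that selects the subgroups intersected
  in \<open>frattini\<close>. Through this inclusion the hypothesis \<Phi>(E) \<le> Z(E) makes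
  \<open>pfrat\<close> central.\<close>

lemma pfrat_le_frattini:
  assumes "prime p" "subgroup E G" "card E = p ^ n"
  shows "pfrat G p E \<subseteq> frattini G E"
  using pfrat_le_maximal[OF assms] pfrat_subset[OF assms(2)]
  unfolding frattini_def maximal_subgroup_def by blast

text \<open>A proper K lies in a maximal subgroup, which also contains \<open>pfrat\<close>; so K
  and \<open>pfrat\<close> together cannot give all of E.\<close>

lemma pfrat_nongenerators:
  assumes "prime p" "subgroup E G" "card E = p ^ n" "subgroup K G" "K \<subseteq> E"
    and KD: "\<And>x. x \<in> E \<Longrightarrow> \<exists>k\<in>K. \<exists>d\<in>pfrat G p E. x = k \<otimes> d"
  shows "K = E"
proof (rule ccontr)
  assume "K \<noteq> E"
  have fin: "finite E" using assms prime_gt_0_nat by (intro card_ge_0_finite) simp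
  obtain M where M: "maximal_subgroup G M E" "K \<subseteq> M"
    using maximal_subgroup_exists[of K E] assms fin \<open>K \<noteq> E\<close> by blast
  have "E \<subseteq> M"
  proof
    fix x assume "x \<in> E"
    then obtain k d where "k \<in> K" "d \<in> pfrat G p E" "x = k \<otimes> d" using KD by blast
    then show "x \<in> M" using M pfrat_le_maximal[OF assms(1-3) M(1)] 
      by (auto simp: maximal_subgroup_def subgroup.m_closed subset_iff)
  qed
  then show False using M by (auto simp: maximal_subgroup_def)
qed

end

text \<open>A homomorphism carries the generating words onto the generating words of the image. This
  yields invariance of \<open>pfrat\<close> under automorphisms and computes it for the image of E
  under an automorphism of the normalizer.\<close>

lemma (in group) pfrat_image:
  assumes E: "subgroup E G" and h: "h \<in> hom (G\<lparr>carrier := E\<rparr>) G"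
  shows "h ` pfrat G p E = pfrat G p (h ` E)"
proof -
  interpret h: group_hom "G\<lparr>carrier := E\<rparr>" G h
    using assms by (simp add: group_hom_def group_hom_axioms_def subgroup_imp_group is_group)
  let ?S = "{x [^] p | x. x \<in> E} \<union> {x \<otimes> y \<otimes> inv x \<otimes> inv y | x y. x \<in> E \<and> y \<in> E}"
  have S: "?S \<subseteq> E"
    using E by (auto simp: subgroup_nat_pow_closed subgroup.m_closed subgroup.m_inv_closed)
  have pow: "h (x [^] p) = h x [^] p" if "x \<in> E" for x
    using h.hom_nat_pow[of x p] that by (simp flip: nat_pow_consistent)
  have inv: "h (inv x) = inv (h x)" if "x \<in> E" for x
    using h.hom_inv[of x] that E by simp
  have mult: "h (x \<otimes> y) = h x \<otimes> h y" if "x \<in> E" "y \<in> E" for x y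
    using h.hom_mult[of x y] that by simp
  have comm: "h (x \<otimes> y \<otimes> inv x \<otimes> inv y) = h x \<otimes> h y \<otimes> inv (h x) \<otimes> inv (h y)"
    if "x \<in> E" "y \<in> E" for x y
    using that E by (simp add: mult inv subgroup.m_closed subgroup.m_inv_closed)
  have "h ` ?S = {x [^] p | x. x \<in> h ` E} \<union> {x \<otimes> y \<otimes> inv x \<otimes> inv y | x y. x \<in> h ` E \<and> y \<in> h ` E}"
    unfolding image_Un by (rule arg_cong2[of _ _ _ _ "(\<union>)"]; (force simp: pow comm image_iff))
  then have "pfrat G p (h ` E) = generate G (h ` ?S)" by (simp add: pfrat_def)
  also have "\<dots> = h ` generate (G\<lparr>carrier := E\<rparr>) ?S"
    by (rule h.generate_img) (use S in simp)
  also have "\<dots> = h ` pfrat G p E" using generate_consistent[OF S E] by (simp add: pfrat_def)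
  finally show ?thesis by simp
qed

section \<open>p-groups of class two\<close>

context group
begin

lemma commute_pow:
  assumes "x \<in> carrier G" "y \<in> carrier G" "x \<otimes> y = y \<otimes> x"
  shows "x [^] (n::nat) \<otimes> y = y \<otimes> x [^] n"
  using assms by (induction n) (simp_all add: m_assoc, simp flip: m_assoc)

text \<open>Each passage of x over a factor y costs one d, and d moves past the remaining y.\<close>

lemma class2_pow_swap:
  assumes "x \<in> carrier G" "y \<in> carrier G" "d \<in> carrier G"
    and "y \<otimes> x = x \<otimes> y \<otimes> d" "d \<otimes> y = y \<otimes> d"
  shows "y [^] (n::nat) \<otimes> x = x \<otimes> y [^] n \<otimes> d [^] n"
proof (induction n)
  case (Suc n)
  have "y [^] Suc n \<otimes> x = (y [^] n \<otimes> x) \<otimes> y \<otimes> d"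
    using assms by (simp add: m_assoc)
  also have "\<dots> = x \<otimes> y [^] n \<otimes> (d [^] n \<otimes> y) \<otimes> d"
    using assms Suc by (simp add: m_assoc)
  also have "d [^] n \<otimes> y = y \<otimes> d [^] n" using assms commute_pow by blast
  finally show ?case using assms by (simp add: m_assoc)
qed (use assms in simp)

text \<open>The exponent of d is n(n-1)/2, kept as a sum so that one induction step adds the n
  factors d that arise when x passes \<open>y [^] n\<close>.\<close>

lemma class2_mult_pow:
  assumes "x \<in> carrier G" "y \<in> carrier G" "d \<in> carrier G"
    and "y \<otimes> x = x \<otimes> y \<otimes> d" "d \<otimes> x = x \<otimes> d" "d \<otimes> y = y \<otimes> d"
  shows "(x \<otimes> y) [^] (n::nat) = x [^] n \<otimes> y [^] n \<otimes> d [^] (\<Sum>i<n. i)"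
proof (induction n)
  case (Suc n)
  let ?t = "\<Sum>i<n. i"
  have dx: "d [^] k \<otimes> x = x \<otimes> d [^] k" and dy: "d [^] k \<otimes> y = y \<otimes> d [^] k" for k :: nat
    using assms commute_pow by blast+
  have "(x \<otimes> y) [^] Suc n = x [^] n \<otimes> y [^] n \<otimes> (d [^] ?t \<otimes> x) \<otimes> y"
    using assms Suc by (simp add: m_assoc)
  also have "\<dots> = x [^] n \<otimes> (y [^] n \<otimes> x) \<otimes> (d [^] ?t \<otimes> y)"
    using assms unfolding dx by (simp add: m_assoc)
  also have "\<dots> = x [^] n \<otimes> (x \<otimes> y [^] n \<otimes> d [^] n) \<otimes> (y \<otimes> d [^] ?t)"
    by (simp only: dy class2_pow_swap[OF assms(1-4,6)])
  also have "\<dots> = x [^] n \<otimes> x \<otimes> y [^] n \<otimes> (d [^] n \<otimes> y) \<otimes> d [^] ?t"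
    using assms by (simp add: m_assoc)
  also have "\<dots> = x [^] Suc n \<otimes> y [^] Suc n \<otimes> (d [^] n \<otimes> d [^] ?t)"
    using assms unfolding dy by (simp add: m_assoc)
  also have "d [^] n \<otimes> d [^] ?t = d [^] (\<Sum>i<Suc n. i)"
    using assms by (simp add: nat_pow_mult add.commute)
  finally show ?case .
qed (use assms in simp)

end

text \<open>The sum is p(p-1)/2, and 2 is coprime to p; oddness of p enters here.\<close>

lemma odd_prime_dvd_triangular:
  assumes "prime (p::nat)" "odd p"
  shows "p dvd (\<Sum>i<p. i)"
proof -
  have "2 * (\<Sum>i<p. i) = p * (p - 1)" for p :: nat
    by (induction p) (auto simp: algebra_simps diff_mult_distrib2)
  then have "p dvd 2 * (\<Sum>i<p. i)" by simp
  moreover have "coprime p 2" using assms by simp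
  ultimately show ?thesis using coprime_dvd_mult_right_iff by blast
qed

text \<open>No fusion system occurs here, so that the locale applies both to E and to its image
  \<open>E0\<close> under an automorphism of the normalizer.\<close>

locale frattini_central = group G for G (structure) +
  fixes p :: nat and E :: "'a set"
  assumes prime: "prime p" and odd: "odd p" and subgroup_E: "subgroup E G"
    and p_power: "\<exists>n. card E = p ^ n"
    and central: "d \<in> pfrat G p E \<Longrightarrow> x \<in> E \<Longrightarrow> d \<otimes> x = x \<otimes> d"
begin

abbreviation "D \<equiv> pfrat G p E"

lemma finite_E: "finite E"
  using p_power prime prime_gt_0_nat by (intro card_ge_0_finite) auto

lemma E_carrier [simp]: "x \<in> E \<Longrightarrow> x \<in> carrier G"
  using subgroup_E subgroup.subset by blast

lemma E_closed [simp]: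
  "x \<in> E \<Longrightarrow> y \<in> E \<Longrightarrow> x \<otimes> y \<in> E" "x \<in> E \<Longrightarrow> inv x \<in> E" "\<one> \<in> E"
  "x \<in> E \<Longrightarrow> x [^] (n::nat) \<in> E"
  using subgroup_E by (auto simp: subgroup.m_closed subgroup.m_inv_closed subgroup.one_closed
    subgroup_nat_pow_closed)

lemma subgroup_D: "subgroup D G" using subgroup_pfrat subgroup_E .

lemma D_E [simp]: "x \<in> D \<Longrightarrow> x \<in> E" using pfrat_subset subgroup_E by blast

lemma D_closed [simp]:
  "x \<in> D \<Longrightarrow> y \<in> D \<Longrightarrow> x \<otimes> y \<in> D" "x \<in> D \<Longrightarrow> inv x \<in> D" "\<one> \<in> D" "x \<in> E \<Longrightarrow> x [^] p \<in> D"
  using subgroup_D by (auto simp: subgroup.m_closed subgroup.m_inv_closed subgroup.one_closed pfrat_pow)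

text \<open>The commutator d has order dividing p because \<open>y [^] p\<close> lies in
  \<open>D\<close> and so commutes with x, while \<open>class2_pow_swap\<close> produces the factor
  \<open>d [^] p\<close>.\<close>

lemma commutator_witness:
  assumes "x \<in> E" "y \<in> E"
  obtains d where "d \<in> D" "y \<otimes> x = x \<otimes> y \<otimes> d" "d [^] p = \<one>"
proof
  \<comment> \<open>This is \<open>inv y inv x y x\<close>, spelt as the commutator of two inverses
    to match the generators of \<open>D\<close>.\<close>
  let ?d = "inv y \<otimes> inv x \<otimes> inv (inv y) \<otimes> inv (inv x)"
  show D: "?d \<in> D" by (rule pfrat_commutator) (use assms in auto)
  show eq: "y \<otimes> x = x \<otimes> y \<otimes> ?d"
    using assms by (simp add: m_assoc) (simp flip: m_assoc)
  have "?d \<otimes> y = y \<otimes> ?d" using central[OF D] assms by blast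
  then have "y [^] p \<otimes> x = x \<otimes> y [^] p \<otimes> ?d [^] p"
    using class2_pow_swap[OF _ _ _ eq, of p] assms D by simp
  moreover have "y [^] p \<otimes> x = x \<otimes> y [^] p" using central assms by simp
  ultimately have "x \<otimes> y [^] p = x \<otimes> y [^] p \<otimes> ?d [^] p" by (rule trans[OF sym, rotated])
  moreover have "?d [^] p \<in> carrier G" using assms by simp
  ultimately show "?d [^] p = \<one>"
    using assms l_cancel_one'[of "x \<otimes> y [^] p" "?d [^] p"] by (simp del: nat_pow_closed)
qed

text \<open>In the class two formula the correction d^(p(p-1)/2) vanishes, since d^p = 1 and p is
  odd.\<close>

lemma pow_mult:
  assumes "x \<in> E" "y \<in> E" shows "(x \<otimes> y) [^] p = x [^] p \<otimes> y [^] p"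
proof -
  obtain d where d: "d \<in> D" "y \<otimes> x = x \<otimes> y \<otimes> d" "d [^] p = \<one>"
    using commutator_witness assms by blast
  obtain k where "(\<Sum>i<p. i) = p * k" using odd_prime_dvd_triangular[OF prime odd] dvdE by blast
  then have "d [^] (\<Sum>i<p. i) = \<one>" using d by (simp flip: nat_pow_pow)
  then show ?thesis using class2_mult_pow[OF _ _ _ d(2) central[OF d(1) assms(1)] central[OF d(1) assms(2)], of p]
      assms d(1) by simp
qed

text \<open>Closure under products is \<open>pow_mult\<close>. Being defined by an equation, this
  subgroup is preserved by automorphisms of E.\<close>

lemma subgroup_pow_p: "subgroup {x \<in> E. x [^] p = \<one>} G"
  by (rule subgroup_finite_closedI) (auto simp: finite_E pow_mult)

lemma subgroup_pow_p2: "subgroup {x \<in> E. (x [^] p) [^] p = \<one>} G"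
  by (rule subgroup_finite_closedI) (auto simp: finite_E pow_mult)

text \<open>The p-th power map is a homomorphism from E into the abelian group \<open>D\<close>, so
  it kills commutators; it kills p-th powers by assumption.\<close>

lemma D_pow_p:
  assumes "\<And>x. x \<in> E \<Longrightarrow> (x [^] p) [^] p = \<one>" "d \<in> D"
  shows "d [^] p = \<one>"
proof -
  have "D \<subseteq> {x \<in> E. x [^] p = \<one>}"
  proof (rule pfrat_leI[OF subgroup_pow_p])
    fix x y assume xy: "x \<in> E" "y \<in> E"
    have "x \<otimes> y \<otimes> inv x \<otimes> inv y = x \<otimes> y \<otimes> (inv x \<otimes> inv y)" using xy by (simp add: m_assoc)
    moreover have "(x \<otimes> y \<otimes> (inv x \<otimes> inv y)) [^] p = (x [^] p \<otimes> y [^] p) \<otimes> (inv (x [^] p) \<otimes> inv (y [^] p))"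
      using xy by (simp add: pow_mult nat_pow_inv)
    moreover have "inv (x [^] p) \<otimes> inv (y [^] p) = inv (y [^] p) \<otimes> inv (x [^] p)"
      using xy by (intro central) auto
    moreover have "inv (y [^] p) \<otimes> inv (x [^] p) = inv (x [^] p \<otimes> y [^] p)"
      using xy by (simp add: inv_mult_group)
    ultimately have "(x \<otimes> y \<otimes> inv x \<otimes> inv y) [^] p = \<one>" using xy by simp
    then show "x \<otimes> y \<otimes> inv x \<otimes> inv y \<in> {x \<in> E. x [^] p = \<one>}" using xy by simp
  qed (use assms in auto)
  then show ?thesis using assms by blast
qed

text \<open>The products \<open>a^i b^j c\<close> with c in the central subgroup C exhaust E, and i,
  j matter only modulo p. With C = \<open>D\<close> this bounds the index of \<open>D\<close>; with
  C generated by one commutator it bounds the order of E.\<close>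

lemma card_le_two_generated:
  assumes ab: "a \<in> E" "b \<in> E" "generate G {a, b} = E"
    and C: "subgroup C G" "C \<subseteq> E" "\<And>c x. c \<in> C \<Longrightarrow> x \<in> E \<Longrightarrow> c \<otimes> x = x \<otimes> c"
    and "a [^] p \<in> C" "b [^] p \<in> C" "d \<in> C" "b \<otimes> a = a \<otimes> b \<otimes> d"
  shows "card E \<le> p * p * card C"
proof -
  note Ccl = subgroup.m_closed[OF C(1)] subgroup.one_closed[OF C(1)] subgroup_nat_pow_closed[OF C(1)]
  have CE [simp]: "c \<in> C \<Longrightarrow> c \<in> E" for c using C by blast
  have CG [simp]: "c \<in> C \<Longrightarrow> c \<in> carrier G" for c using C by simp
  have [simp]: "a \<in> carrier G" "b \<in> carrier G" using ab by auto
  define U where "U = {a [^] i \<otimes> b [^] j \<otimes> c | (i::nat) (j::nat) c. c \<in> C}"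
  have UE: "U \<subseteq> E" using ab(1,2) by (auto simp: U_def)
  have Ua: "u \<otimes> a \<in> U" if u_in: "u \<in> U" for u
  proof -
    obtain i j c where u: "u = a [^] (i::nat) \<otimes> b [^] (j::nat) \<otimes> c" "c \<in> C"
      using u_in unfolding U_def by blast
    have "u \<otimes> a = a [^] i \<otimes> (b [^] j \<otimes> a) \<otimes> c" using u C(3)[OF u(2) ab(1)] by (simp add: m_assoc)
    also have "\<dots> = a [^] Suc i \<otimes> b [^] j \<otimes> (d [^] j \<otimes> c)"
      using u class2_pow_swap[OF _ _ _ assms(10)] C(3) ab assms(9) by (simp add: m_assoc)
    finally show ?thesis using Ccl u assms(9) unfolding U_def by blast
  qed
  have Ub: "u \<otimes> b \<in> U" if u_in: "u \<in> U" for u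
  proof -
    obtain i j c where u: "u = a [^] (i::nat) \<otimes> b [^] (j::nat) \<otimes> c" "c \<in> C"
      using u_in unfolding U_def by blast
    have "u \<otimes> b = a [^] i \<otimes> b [^] Suc j \<otimes> c" using u C(3)[OF u(2) ab(2)] by (simp add: m_assoc)
    then show ?thesis using u unfolding U_def by blast
  qed
  \<comment> \<open>U is closed under right multiplication by a and b, so its stabilizer is a
    subgroup containing both generators, hence E. As \<open>\<one>\<close> lies in U, so does every
    element of E.\<close>
  let ?S = "{x \<in> E. \<forall>u\<in>U. u \<otimes> x \<in> U}"
  have "subgroup ?S G"
  proof (rule subgroup_finite_closedI)
    fix x y assume xy: "x \<in> ?S" "y \<in> ?S"
    have "u \<otimes> (x \<otimes> y) \<in> U" if "u \<in> U" for u
    proof -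
      have "u \<otimes> (x \<otimes> y) = (u \<otimes> x) \<otimes> y" using that UE xy by (simp add: m_assoc subset_iff)
      then show ?thesis using that xy by simp
    qed
    then show "x \<otimes> y \<in> ?S" using xy by simp
  qed (use finite_E UE in \<open>auto simp: subset_iff\<close>)
  moreover have "{a, b} \<subseteq> ?S" using ab Ua Ub by auto
  ultimately have ES: "E \<subseteq> ?S" using generate_subgroup_incl[of "{a, b}" ?S] unfolding ab(3) by blast
  have "\<one> \<in> U"
  proof -
    have "\<one> = a [^] (0::nat) \<otimes> b [^] (0::nat) \<otimes> \<one>" by simp
    then show ?thesis using Ccl(2) unfolding U_def by blast
  qed
  then have "\<one> \<otimes> x \<in> U" if "x \<in> E" for x using ES that by blast
  then have EU: "E \<subseteq> U" by auto
  have p0: "0 < p" using prime prime_gt_0_nat by blast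
  have "U \<subseteq> (\<lambda>(i, j, c). a [^] i \<otimes> b [^] j \<otimes> c) ` ({..<p} \<times> {..<p} \<times> C)"
  proof
    fix u assume "u \<in> U"
    then obtain i j c where u: "u = a [^] (i::nat) \<otimes> b [^] (j::nat) \<otimes> c" "c \<in> C"
      by (auto simp: U_def)
    \<comment> \<open>The excess powers lie in C, as \<open>a [^] p\<close> and
      \<open>b [^] p\<close> do, and are merged into c.\<close>
    let ?ca = "(a [^] p) [^] (i div p)" and ?cb = "(b [^] p) [^] (j div p)"
    have "a [^] i = a [^] (i mod p) \<otimes> ?ca" "b [^] j = b [^] (j mod p) \<otimes> ?cb"
      by (simp_all add: nat_pow_pow nat_pow_mult)
    moreover have c: "?ca \<in> C" "?cb \<in> C" using Ccl assms(7,8) by auto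
    ultimately have "u = a [^] (i mod p) \<otimes> (?ca \<otimes> b [^] (j mod p)) \<otimes> ?cb \<otimes> c"
      using u by (simp add: m_assoc)
    also have "\<dots> = a [^] (i mod p) \<otimes> b [^] (j mod p) \<otimes> (?ca \<otimes> ?cb \<otimes> c)"
      using c u ab C(3)[OF c(1), of "b [^] (j mod p)"] by (simp add: m_assoc)
    finally have "u = (\<lambda>(i, j, c). a [^] i \<otimes> b [^] j \<otimes> c) (i mod p, j mod p, ?ca \<otimes> ?cb \<otimes> c)"
      by simp
    moreover have "(i mod p, j mod p, ?ca \<otimes> ?cb \<otimes> c) \<in> {..<p} \<times> {..<p} \<times> C"
      using c u Ccl p0 by auto
    ultimately show "u \<in> (\<lambda>(i, j, c). a [^] i \<otimes> b [^] j \<otimes> c) ` ({..<p} \<times> {..<p} \<times> C)"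
      by (rule image_eqI)
  qed
  then have "E \<subseteq> (\<lambda>(i, j, c). a [^] i \<otimes> b [^] j \<otimes> c) ` ({..<p} \<times> {..<p} \<times> C)" using EU by blast
  moreover have "finite ({..<p} \<times> {..<p} \<times> C)" using finite_subset[OF C(2) finite_E] by simp
  ultimately have "card E \<le> card ({..<p} \<times> {..<p} \<times> C)" by (metis surj_card_le)
  then show ?thesis by (simp add: card_cartesian_product)
qed

lemma subgroup_mult_D:
  assumes "subgroup K G" "K \<subseteq> E"
  shows "subgroup {k \<otimes> d | k d. k \<in> K \<and> d \<in> D} G"
proof (rule subgroup_finite_closedI)
  let ?S = "{k \<otimes> d | k d. k \<in> K \<and> d \<in> D}"
  have "?S \<subseteq> E" using assms by auto
  then show "finite ?S" "?S \<subseteq> carrier G"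
    using finite_E finite_subset subgroup.subset[OF subgroup_E] by blast+
  show "\<one> \<in> ?S" using subgroup.one_closed[OF assms(1)] by (auto intro!: exI[of _ \<one>])
  fix x y assume "x \<in> ?S" "y \<in> ?S"
  then obtain k d l e where x: "x = k \<otimes> d" "k \<in> K" "d \<in> D" and y: "y = l \<otimes> e" "l \<in> K" "e \<in> D"
    by auto
  have "x \<otimes> y = k \<otimes> (d \<otimes> l) \<otimes> e" using x y assms by (auto simp: m_assoc subset_iff)
  also have "\<dots> = (k \<otimes> l) \<otimes> (d \<otimes> e)"
    using x y assms central[of d l] by (auto simp: m_assoc subset_iff)
  finally show "x \<otimes> y \<in> ?S" using x y subgroup.m_closed[OF assms(1)] D_closed(1) by blast
qed

lemma nongenerators:
  assumes "subgroup K G" "K \<subseteq> E" "E \<subseteq> {k \<otimes> d | k d. k \<in> K \<and> d \<in> D}"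
  shows "K = E"
proof -
  obtain n where "card E = p ^ n" using p_power by blast
  then show ?thesis using pfrat_nongenerators[OF prime subgroup_E _ assms(1,2)] assms(3) by blast
qed

lemma card_D_power: obtains k where "card D = p ^ k"
proof -
  obtain n where "card E = p ^ n" using p_power by blast
  then show ?thesis
    using p_group_subgroup_card[OF is_group prime subgroup_D subgroup_E pfrat_subset[OF subgroup_E]] that
    by blast
qed

text \<open>The bound |E : D| \<le> p^2 is \<open>card_le_two_generated\<close>. If the index were
  at most p, then E would be generated by one element together with the nongenerators in
  \<open>D\<close>, hence by that element alone.\<close>

lemma card_eq_two_generated:
  assumes ab: "a \<in> E" "b \<in> E" "generate G {a, b} = E"
    and noncyclic: "\<And>e. e \<in> E \<Longrightarrow> generate G {e} \<noteq> E"
  shows "card E = p * p * card D"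
proof -
  obtain d where d: "d \<in> D" "b \<otimes> a = a \<otimes> b \<otimes> d" using commutator_witness ab(1,2) by blast
  have le: "card E \<le> p * p * card D"
    by (rule card_le_two_generated[OF ab subgroup_D _ central _ _ d]) (use ab(1,2) in auto)
  obtain n where n: "card E = p ^ n" using p_power by blast
  obtain k where k: "card D = p ^ k" using card_D_power by blast
  have p1: "1 < p" using prime prime_gt_1_nat by blast
  have "p ^ n \<le> p ^ (k + 2)" using le n k by (simp add: power2_eq_square mult_ac power_add)
  then have "n \<le> k + 2" by (rule power_le_imp_le_exp[OF p1])
  moreover have "\<not> n \<le> Suc k"
  proof
    assume nk: "n \<le> Suc k"
    have "card D \<le> card E" using finite_E by (intro card_mono) auto
    then have "k \<le> n" using n k p1 by simp
    \<comment> \<open>For index 1 the witness is \<open>\<one>\<close>; for index p it is any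
      element outside \<open>D\<close>.\<close>
    have "\<exists>e\<in>E. subgroup (generate G {e}) G \<and> E \<subseteq> {k \<otimes> d | k d. k \<in> generate G {e} \<and> d \<in> D}"
    proof (cases "n = k")
      case True
      then have "D = E" using n k finite_E by (intro card_subset_eq) auto
      have one: "\<one> \<in> generate G {\<one>}" by (rule generate.one)
      have "x \<in> {k \<otimes> d | k d. k \<in> generate G {\<one>} \<and> d \<in> D}" if "x \<in> E" for x
      proof -
        have "x = \<one> \<otimes> x" using that by simp
        then show ?thesis using that one \<open>D = E\<close> by blast
      qed
      then show ?thesis using generate_is_subgroup[of "{\<one>}"] by (intro bexI[of _ \<one>]) auto
    next
      case False
      with nk \<open>k \<le> n\<close> have n': "n = Suc k" by simp
      then have cE: "card E = p * card D" using n k by simp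
      then have "D \<noteq> E" using finite_E p1 n k n' by auto
      then obtain e where e: "e \<in> E" "e \<notin> D" by (meson D_E subsetI subset_antisym)
      let ?K = "generate G {e}" and ?KD = "{k \<otimes> d | k d. k \<in> generate G {e} \<and> d \<in> D}"
      have K: "subgroup ?K G" "?K \<subseteq> E"
        using e generate_is_subgroup[of "{e}"] generate_subgroup_incl[of "{e}" E] subgroup_E by auto
      have "D \<subseteq> ?KD"
      proof
        fix x assume "x \<in> D"
        then have "x = \<one> \<otimes> x" by simp
        then show "x \<in> ?KD" using generate.one \<open>x \<in> D\<close> by blast
      qed
      moreover have "?KD \<subseteq> E" using K by auto
      ultimately have "?KD = D \<or> ?KD = E"
        using subgroup_between_prime_index[OF subgroup_D subgroup_mult_D[OF K] subgroup_E] finite_E prime cE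
        by blast
      moreover have "e \<in> ?KD"
      proof -
        have "e = e \<otimes> \<one>" using e by simp
        moreover have "e \<in> ?K" by (rule generate.incl) simp
        ultimately show ?thesis using D_closed(3) by blast
      qed
      ultimately have "?KD = E" using e(2) by blast
      then show ?thesis using K(1) e(1) equalityD2 by blast
    qed
    then obtain e where e: "e \<in> E" "subgroup (generate G {e}) G"
      "E \<subseteq> {k \<otimes> d | k d. k \<in> generate G {e} \<and> d \<in> D}" by blast
    have "generate G {e} \<subseteq> E" using generate_subgroup_incl[of "{e}" E] subgroup_E e by simp
    then show False using nongenerators e noncyclic by blast
  qed
  ultimately have "n = k + 2" by simp
  then show ?thesis using n k by (simp add: power_add power2_eq_square)
qed

text \<open>If E is abelian, then \<open>D\<close> is trivial. Otherwise the powers of d = [b, a]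
  serve as C and give |E| \<le> p^3, so |D| \<le> p; and a trivial \<open>D\<close> would make E
  abelian.\<close>

lemma exponent_p_two_generated:
  assumes ab: "a \<in> E" "b \<in> E" "generate G {a, b} = E"
    and noncyclic: "\<And>e. e \<in> E \<Longrightarrow> generate G {e} \<noteq> E"
    and exp: "\<And>x. x \<in> E \<Longrightarrow> x [^] p = \<one>"
  shows "if abelian_sub G E then card E = p ^ 2 else card E = p ^ 3"
proof -
  note card = card_eq_two_generated[OF ab noncyclic]
  show ?thesis
  proof (cases "abelian_sub G E")
    case True
    have "D \<subseteq> {\<one>}"
    proof (rule pfrat_leI)
      fix x y assume xy: "x \<in> E" "y \<in> E"
      then have "x \<otimes> y = y \<otimes> x" using True by (simp add: abelian_sub_def)
      then have "x \<otimes> y \<otimes> inv x \<otimes> inv y = y \<otimes> (x \<otimes> inv x) \<otimes> inv y" using xy by (simp add: m_assoc)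
      then show "x \<otimes> y \<otimes> inv x \<otimes> inv y \<in> {\<one>}" using xy by simp
    qed (auto simp: exp triv_subgroup)
    then have "D = {\<one>}" using D_closed(3) by blast
    then show ?thesis using card True by (simp add: power2_eq_square)
  next
    case False
    obtain d where d: "d \<in> D" "b \<otimes> a = a \<otimes> b \<otimes> d" "d [^] p = \<one>"
      using commutator_witness ab by blast
    have p0: "0 < p" using prime prime_gt_0_nat by blast
    \<comment> \<open>The cyclic group of d, as the set of natural powers; inverses come from
      finiteness.\<close>
    define C where "C = range (\<lambda>i::nat. d [^] i)"
    have "C \<subseteq> (\<lambda>i. d [^] i) ` {..<p}"
    proof
      fix c assume "c \<in> C"
      then obtain i :: nat where "c = d [^] i" by (auto simp: C_def)
      also have "\<dots> = d [^] (p * (i div p) + i mod p)" by simp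
      also have "\<dots> = (d [^] p) [^] (i div p) \<otimes> d [^] (i mod p)"
        using d(1) by (simp only: nat_pow_pow nat_pow_mult E_carrier D_E)
      also have "\<dots> = d [^] (i mod p)" using d by simp
      finally show "c \<in> (\<lambda>i. d [^] i) ` {..<p}" using p0 by auto
    qed
    then have cC: "card C \<le> p" and fC: "finite C"
      using surj_card_le[of "{..<p}" C] finite_surj[of "{..<p}" C] by auto
    have CD: "C \<subseteq> D" using subgroup_nat_pow_closed[OF subgroup_D d(1)] by (auto simp: C_def)
    have "subgroup C G"
    proof (rule subgroup_finite_closedI)
      show "\<one> \<in> C" unfolding C_def by (rule image_eqI[of _ _ 0]) auto
      show "\<And>x y. x \<in> C \<Longrightarrow> y \<in> C \<Longrightarrow> x \<otimes> y \<in> C" using d by (auto simp: C_def nat_pow_mult)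
    qed (use CD fC in auto)
    moreover have "a [^] p \<in> C" "b [^] p \<in> C"
      using ab exp \<open>subgroup C G\<close> by (auto simp: subgroup.one_closed)
    moreover have "d \<in> C" unfolding C_def by (rule image_eqI[of _ _ 1]) (use d in auto)
    moreover have "C \<subseteq> E" using CD by auto
    moreover have "c \<otimes> x = x \<otimes> c" if "c \<in> C" "x \<in> E" for c x using that CD central by blast
    ultimately have "card E \<le> p * p * card C"
      using card_le_two_generated[OF ab, of C d] d(2) by blast
    then have "card D \<le> p" using card cC p0
      by (metis (no_types, opaque_lifting) le_trans mult_le_cancel1 nat_0_less_mult_iff)
    moreover obtain k where k: "card D = p ^ k" using card_D_power by blast
    moreover have p1: "1 < p" using prime prime_gt_1_nat by blast
    ultimately have "k \<le> 1" by (metis power_increasing_iff power_one_right)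
    moreover have "k \<noteq> 0"
    proof
      assume "k = 0"
      then have "D = {\<one>}" using k D_closed(3) by (metis card_1_singletonE power_0 singletonD)
      have "x \<otimes> y = y \<otimes> x" if xy: "x \<in> E" "y \<in> E" for x y
      proof -
        obtain d' where "d' \<in> D" "y \<otimes> x = x \<otimes> y \<otimes> d'" using commutator_witness xy by blast
        then show ?thesis using \<open>D = {\<one>}\<close> xy by simp
      qed
      then show False using False by (auto simp: abelian_sub_def)
    qed
    ultimately have "k = 1" by simp
    then show ?thesis using card k False by (simp add: power3_eq_cube)
  qed
qed

end

section \<open>Strongly p-embedded subgroups\<close>

lemma prime_power_if_unique_prime_divisor:
  assumes "0 < (n::nat)" "\<And>q. prime q \<Longrightarrow> q dvd n \<Longrightarrow> q = p"
  shows "\<exists>k. n = p ^ k"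
  using assms
proof (induction n rule: less_induct)
  case (less n)
  show ?case
  proof (cases "n = 1")
    case False
    then obtain q where q: "prime q" "q dvd n" using prime_factor_nat by blast
    then obtain m where m: "n = p * m" using less by blast
    have "q = p" using q less by blast
    then have "1 < p" using q prime_gt_1_nat by blast
    then have "m < n" "0 < m" using m less(2) by auto
    then obtain k where "m = p ^ k" using less m by (metis dvd_mult)
    then have "n = p ^ Suc k" using m by simp
    then show ?thesis by blast
  qed (auto intro: exI[of _ 0])
qed

text \<open>For x outside M, the group R = x R x^-1 would lie in the intersection of M with its
  conjugate by x, whose order is prime to p.\<close>

lemma (in group) strongly_p_embedded_normalizer:
  assumes fin: "finite (carrier G)" and M: "strongly_p_embedded G p M"
    and R: "subgroup R G" "R \<subseteq> M" "p dvd card R"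
    and x: "x \<in> carrier G" "\<And>r. r \<in> R \<Longrightarrow> x \<otimes> r \<otimes> inv x \<in> R"
  shows "x \<in> M"
proof (rule ccontr)
  assume "x \<notin> M"
  have Msub: "subgroup M G" using M by (simp add: strongly_p_embedded_def)
  have RG: "R \<subseteq> carrier G" "finite R" 
    using subgroup.subset[OF R(1)] finite_subset[OF _ fin] by simp_all
  let ?M' = "x <# M #> inv x"
  have M': "?M' = (\<lambda>m. x \<otimes> m \<otimes> inv x) ` M" by (auto simp: l_coset_def r_coset_def)
  have inj: "inj_on (\<lambda>m. x \<otimes> m \<otimes> inv x) R"
    using RG x(1) conjugation_is_inj[of x] by (intro inj_onI) blast
  have "(\<lambda>m. x \<otimes> m \<otimes> inv x) ` R = R"
  proof (rule card_subset_eq[OF RG(2)])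
    show "(\<lambda>m. x \<otimes> m \<otimes> inv x) ` R \<subseteq> R" using x(2) by blast
    show "card ((\<lambda>m. x \<otimes> m \<otimes> inv x) ` R) = card R" by (rule card_image[OF inj])
  qed
  then have "R \<subseteq> ?M'" unfolding M' using R(2) by blast
  moreover have "subgroup ?M' G" using Msub x(1)
    by (intro subgroup_conjugation_is_surj2)
  then have "subgroup (M \<inter> ?M') G" using Msub subgroups_Inter_pair by blast
  moreover have "finite (M \<inter> ?M')" using finite_subset[OF subgroup.subset[OF Msub] fin] by simp
  ultimately have "card R dvd card (M \<inter> ?M')" using card_subgroup_dvd R by simp
  then have "p dvd card (M \<inter> ?M')" using R(3) dvd_trans by blast
  then show False using M x(1) \<open>x \<notin> M\<close> by (auto simp: strongly_p_embedded_def)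
qed

text \<open>A subgroup P of order p of M centralizes some z \<noteq> 1 in N. As z normalizes P, it
  lies in M, so M \<inter> N is a nontrivial p-group. Elements normalizing such a subgroup of M stay
  in M: growth of normalizers inside N then gives N \<le> M, and normality of N gives M = G.\<close>

lemma (in group) strongly_p_embedded_normal_p_subgroup:
  assumes fin: "finite (carrier G)" and p: "prime p" and M: "strongly_p_embedded G p M"
    and N: "N \<lhd> G" "card N = p ^ k"
  shows "N = {\<one>}"
proof (rule ccontr)
  assume ne: "N \<noteq> {\<one>}"
  note in_M = strongly_p_embedded_normalizer[OF fin M]
  have Msub: "subgroup M G" "M \<noteq> carrier G" "p dvd card M"
    using M by (auto simp: strongly_p_embedded_def)
  have Nsub: "subgroup N G" using N normal_imp_subgroup by blast
  have NG: "N \<subseteq> carrier G" "finite N" "M \<subseteq> carrier G" "finite M"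
    using subgroup.subset[OF Nsub] subgroup.subset[OF Msub(1)] finite_subset[OF _ fin] by simp_all
  have Nconj: "x \<otimes> n \<otimes> inv x \<in> N" if "x \<in> carrier G" "n \<in> N" for x n
    using that N by (simp add: normal_inv_iff)
  have card_dvd: "p dvd card R" if R: "subgroup R G" "R \<subseteq> N" "R \<noteq> {\<one>}" for R
  proof -
    obtain j where j: "card R = p ^ j"
      using p_group_subgroup_card[OF is_group p R(1) Nsub R(2) N(2)] by blast
    have "j \<noteq> 0"
    proof
      assume "j = 0"
      then obtain r where "R = {r}" using j card_1_singletonE by auto
      then show False using subgroup.one_closed[OF R(1)] R(3) by auto
    qed
    then show ?thesis using j by simp
  qed
  interpret MG: group "G\<lparr>carrier := M\<rparr>" using Msub by (simp add: subgroup_imp_group)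
  obtain m where "card M = p * m" using Msub(3) by blast
  then obtain P where P: "subgroup P (G\<lparr>carrier := M\<rparr>)" "card P = p"
    using sylow_thm[OF p MG.is_group, of 1 m] NG by (auto simp: order_def)
  have PM: "subgroup P G" "P \<subseteq> M"
    using P incl_subgroup[OF Msub(1)] subgroup.subset by fastforce+
  have PG: "P \<subseteq> carrier G" using PM NG by blast
  interpret PG: group "G\<lparr>carrier := P\<rparr>" using PM by (simp add: subgroup_imp_group)
  obtain z where z: "z \<in> N" "z \<noteq> \<one>" "\<And>g. g \<in> P \<Longrightarrow> inv g \<otimes> z \<otimes> g = z"
  proof (rule PG.fixed_point_exists[of p 1 N \<one> "\<lambda>g x. inv g \<otimes> x \<otimes> g"])
    show "p dvd card N" using card_dvd[OF Nsub] ne by blast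
    show "\<one> \<in> N" using subgroup.one_closed[OF Nsub] .
    show "\<And>g. g \<in> carrier (G\<lparr>carrier := P\<rparr>) \<Longrightarrow> inv g \<otimes> \<one> \<otimes> g = \<one>"
      using PG by auto
    fix g x assume g: "g \<in> carrier (G\<lparr>carrier := P\<rparr>)" and x: "x \<in> N"
    then have "g \<in> carrier G" using PG by auto
    then show "inv g \<otimes> x \<otimes> g \<in> N" using Nconj[of "inv g" x] x by simp
    fix h assume h: "h \<in> carrier (G\<lparr>carrier := P\<rparr>)"
    then show "inv (g \<otimes>\<^bsub>G\<lparr>carrier := P\<rparr>\<^esub> h) \<otimes> x \<otimes> (g \<otimes>\<^bsub>G\<lparr>carrier := P\<rparr>\<^esub> h) =
      inv h \<otimes> (inv g \<otimes> x \<otimes> g) \<otimes> h"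
      using g x PG NG by (simp add: m_assoc inv_mult_group subset_iff)
  qed (use p P NG in \<open>auto simp: order_def\<close>)
  have zG: "z \<in> carrier G" using z NG by blast
  have "z \<in> M"
  proof (rule in_M[OF PM])
    fix r assume r: "r \<in> P"
    then have rG: "r \<in> carrier G" using PG by blast
    have "r \<otimes> z = r \<otimes> (inv r \<otimes> z \<otimes> r)" using z(3)[OF r] by simp
    also have "\<dots> = z \<otimes> r" using zG rG by (simp add: m_assoc[symmetric])
    finally have "z \<otimes> r \<otimes> inv z = r \<otimes> z \<otimes> inv z" by (simp only:)
    then show "z \<otimes> r \<otimes> inv z \<in> P" using r zG rG by (simp add: m_assoc)
  qed (use zG P in auto)
  have R: "subgroup (M \<inter> N) G" using Msub Nsub subgroups_Inter_pair by blast
  have "p dvd card (M \<inter> N)" using card_dvd[OF R] \<open>z \<in> M\<close> z by blast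
  note in_M_R = in_M[OF R _ this]
  have "N \<subseteq> M"
  proof (rule ccontr)
    assume "\<not> N \<subseteq> M"
    then have "M \<inter> N \<subset> N" by blast
    then obtain w where "w \<in> N" "w \<notin> M \<inter> N" "\<And>m. m \<in> M \<inter> N \<Longrightarrow> w \<otimes> m \<otimes> inv w \<in> M \<inter> N"
      using normalizer_grows[OF p R Nsub _ N(2)] by blast
    then show False using in_M_R[of w] NG by auto
  qed
  then have "carrier G \<subseteq> M"
    using in_M[OF Nsub _ card_dvd[OF Nsub]] ne Nconj by blast
  then show False using Msub NG by blast
qed

lemma (in group_hom) order_dvd_if_surj:
  assumes "h ` carrier G = carrier H"
  shows "order H dvd order G"
proof -
  have "(\<lambda>X. the_elem (h ` X)) \<in> iso (G Mod kernel G H h) H"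
    by (rule FactGroup_iso_set[OF assms])
  then have "order (G Mod kernel G H h) = order H"
    by (rule iso_same_order)
  then show ?thesis
    using G.lagrange[OF subgroup_kernel] by (metis dvd_triv_left order_def FactGroup_def partial_object.select_convs(1))
qed

section \<open>Automorphism groups in a fusion system\<close>

locale essential_frattini_central = frattini_central G p E for G (structure) and p E +
  fixes F :: "'a set \<Rightarrow> 'a set \<Rightarrow> ('a \<Rightarrow> 'a) set"
  assumes fusion: "fusion_system G F"
    and ess: "essential G p F E"
begin

abbreviation "Aut \<equiv> AutGrp F E"

lemma carrier_Aut [simp]: "carrier Aut = F E E" by (simp add: AutGrp_def)

lemma mult_Aut [simp]: "\<alpha> \<otimes>\<^bsub>Aut\<^esub> \<beta> = compose E \<beta> \<alpha>" by (simp add: AutGrp_def)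

lemma one_Aut [simp]: "\<one>\<^bsub>Aut\<^esub> = restrict id E" by (simp add: AutGrp_def)

lemma aut_inj_hom: "\<beta> \<in> F E E \<Longrightarrow> inj_hom G E E \<beta>"
  using fusion subgroup_E unfolding fusion_system_def by blast

lemma aut_closed [simp]: "\<beta> \<in> F E E \<Longrightarrow> x \<in> E \<Longrightarrow> \<beta> x \<in> E"
  using aut_inj_hom[of \<beta>] by (auto simp: inj_hom_def hom_def)

lemma aut_mult [simp]: "\<beta> \<in> F E E \<Longrightarrow> x \<in> E \<Longrightarrow> y \<in> E \<Longrightarrow> \<beta> (x \<otimes> y) = \<beta> x \<otimes> \<beta> y"
  using aut_inj_hom[of \<beta>] by (auto simp: inj_hom_def hom_def)

lemma aut_inj: "\<beta> \<in> F E E \<Longrightarrow> inj_on \<beta> E"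
  using aut_inj_hom[of \<beta>] by (auto simp: inj_hom_def)

lemma aut_extensional: "\<beta> \<in> F E E \<Longrightarrow> \<beta> \<in> extensional E"
  using aut_inj_hom[of \<beta>] by (auto simp: inj_hom_def)

lemma aut_image: "\<beta> \<in> F E E \<Longrightarrow> \<beta> ` E = E"
  using aut_inj card_image by (intro card_subset_eq) (auto simp: finite_E)

lemma aut_one [simp]: "\<beta> \<in> F E E \<Longrightarrow> \<beta> \<one> = \<one>"
  using aut_mult[of \<beta> \<one> \<one>] by simp

lemma aut_inv [simp]: "\<beta> \<in> F E E \<Longrightarrow> x \<in> E \<Longrightarrow> \<beta> (inv x) = inv (\<beta> x)"
  using aut_mult[of \<beta> "inv x" x] by (intro inv_equality[symmetric]) auto

lemma aut_D: assumes "\<beta> \<in> F E E" "d \<in> D" shows "\<beta> d \<in> D"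
proof -
  have "\<beta> \<in> hom (G\<lparr>carrier := E\<rparr>) G" using assms by (auto simp: hom_def)
  then have "\<beta> ` D = D" using pfrat_image[OF subgroup_E] aut_image assms by metis
  then show ?thesis using assms by blast
qed

lemma conjm_Aut:
  assumes "g \<in> carrier G" "\<And>x. x \<in> E \<Longrightarrow> inv g \<otimes> x \<otimes> g \<in> E"
  shows "conjm G g E \<in> F E E"
proof -
  have "conjm G g E \<in> HomS G E E" using assms by (auto simp: HomS_def)
  then show ?thesis using fusion subgroup_E unfolding fusion_system_def by blast
qed

lemma finite_Aut: "finite (F E E)"
proof (rule finite_subset)
  show "F E E \<subseteq> (E \<rightarrow>\<^sub>E E)" using aut_extensional by (auto simp: PiE_def)
  show "finite (E \<rightarrow>\<^sub>E E)" using finite_E by (simp add: finite_PiE)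
qed

lemma group_Aut: "group Aut"
proof (rule groupI)
  show "\<And>x y. x \<in> carrier Aut \<Longrightarrow> y \<in> carrier Aut \<Longrightarrow> x \<otimes>\<^bsub>Aut\<^esub> y \<in> carrier Aut"
    using fusion unfolding fusion_system_def carrier_Aut mult_Aut by blast
  have "conjm G \<one> E \<in> F E E" by (rule conjm_Aut) auto
  moreover have "conjm G \<one> E = restrict id E" by (auto simp: conjm_def)
  ultimately show "\<one>\<^bsub>Aut\<^esub> \<in> carrier Aut" by simp
next
  fix x y z assume "x \<in> carrier Aut" "y \<in> carrier Aut" "z \<in> carrier Aut"
  then show "x \<otimes>\<^bsub>Aut\<^esub> y \<otimes>\<^bsub>Aut\<^esub> z = x \<otimes>\<^bsub>Aut\<^esub> (y \<otimes>\<^bsub>Aut\<^esub> z)"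
    by (auto simp: compose_def fun_eq_iff)
next
  fix x assume x: "x \<in> carrier Aut"
  then show "\<one>\<^bsub>Aut\<^esub> \<otimes>\<^bsub>Aut\<^esub> x = x"
    using aut_extensional[of x] by (auto simp: compose_def fun_eq_iff extensional_def)
  let ?y = "restrict (inv_into E x) E"
  have "restrict (inv_into E x) (x ` E) \<in> F (x ` E) E"
    using fusion x unfolding fusion_system_def carrier_Aut by blast
  then have "?y \<in> carrier Aut" using x aut_image by simp
  moreover have "?y \<otimes>\<^bsub>Aut\<^esub> x = \<one>\<^bsub>Aut\<^esub>"
    using x aut_image[of x] f_inv_into_f[of _ x E] by (auto simp: compose_def fun_eq_iff)
  ultimately show "\<exists>y\<in>carrier Aut. y \<otimes>\<^bsub>Aut\<^esub> x = \<one>\<^bsub>Aut\<^esub>" by blast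
qed

interpretation Aut: group Aut by (rule group_Aut)

lemma Inn_Aut: "Inn G E \<subseteq> F E E"
  by (auto simp: Inn_def intro: conjm_Aut)

lemma aut_inv_apply:
  assumes "\<beta> \<in> F E E" "x \<in> E"
  shows "(inv\<^bsub>Aut\<^esub> \<beta>) (\<beta> x) = x" "\<beta> ((inv\<^bsub>Aut\<^esub> \<beta>) x) = x"
proof -
  have "\<beta> \<otimes>\<^bsub>Aut\<^esub> inv\<^bsub>Aut\<^esub> \<beta> = \<one>\<^bsub>Aut\<^esub>" "inv\<^bsub>Aut\<^esub> \<beta> \<otimes>\<^bsub>Aut\<^esub> \<beta> = \<one>\<^bsub>Aut\<^esub>"
    using assms Aut.r_inv[of \<beta>] Aut.l_inv[of \<beta>] by (simp_all only: carrier_Aut)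
  then show "(inv\<^bsub>Aut\<^esub> \<beta>) (\<beta> x) = x" "\<beta> ((inv\<^bsub>Aut\<^esub> \<beta>) x) = x"
    using assms by (auto simp: compose_def dest: fun_cong[of _ _ x])
qed

text \<open>\<gamma> stands for the inverse of \<beta>, described by its values, so that normality
  can be checked pointwise on E. Closure under inverses is automatic because \<open>F E E\<close> is
  finite.\<close>

lemma Aut_normalI:
  assumes "Q \<subseteq> F E E" "\<one>\<^bsub>Aut\<^esub> \<in> Q"
    and "\<And>\<alpha> \<beta>. \<alpha> \<in> Q \<Longrightarrow> \<beta> \<in> Q \<Longrightarrow> compose E \<beta> \<alpha> \<in> Q"
    and "\<And>\<beta> \<gamma> \<alpha>. \<beta> \<in> F E E \<Longrightarrow> \<gamma> \<in> F E E \<Longrightarrow> (\<And>x. x \<in> E \<Longrightarrow> \<gamma> (\<beta> x) = x) \<Longrightarrow>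
      (\<And>x. x \<in> E \<Longrightarrow> \<beta> (\<gamma> x) = x) \<Longrightarrow> \<alpha> \<in> Q \<Longrightarrow>
      compose E \<gamma> (compose E \<alpha> \<beta>) \<in> Q"
  shows "Q \<lhd> Aut"
  unfolding Aut.normal_inv_iff
proof (intro conjI ballI)
  show "subgroup Q Aut"
    by (rule Aut.subgroup_finite_closedI) (use assms(1-3) finite_Aut finite_subset in auto)
  fix \<beta> \<alpha> assume "\<beta> \<in> carrier Aut" "\<alpha> \<in> Q"
  then show "\<beta> \<otimes>\<^bsub>Aut\<^esub> \<alpha> \<otimes>\<^bsub>Aut\<^esub> inv\<^bsub>Aut\<^esub> \<beta> \<in> Q"
    using assms(4)[of \<beta> "inv\<^bsub>Aut\<^esub> \<beta>" \<alpha>] aut_inv_apply Aut.inv_closed[of \<beta>] by simp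
qed

lemma Inn_normal: "Inn G E \<lhd> Aut"
proof (rule Aut_normalI[OF Inn_Aut])
  show "\<one>\<^bsub>Aut\<^esub> \<in> Inn G E"
    by (auto simp: Inn_def conjm_def fun_eq_iff intro!: exI[of _ \<one>])
next
  fix \<alpha> \<beta> assume "\<alpha> \<in> Inn G E" "\<beta> \<in> Inn G E"
  then obtain g h where gh: "g \<in> E" "h \<in> E" "\<alpha> = conjm G g E" "\<beta> = conjm G h E"
    by (auto simp: Inn_def)
  then have "compose E \<beta> \<alpha> = conjm G (g \<otimes> h) E"
    by (auto simp: compose_def conjm_def fun_eq_iff m_assoc inv_mult_group)
  then show "compose E \<beta> \<alpha> \<in> Inn G E" using gh by (auto simp: Inn_def)
next
  fix \<beta> \<gamma> \<alpha> assume bg: "\<beta> \<in> F E E" "\<gamma> \<in> F E E" "\<And>x. x \<in> E \<Longrightarrow> \<gamma> (\<beta> x) = x" and "\<alpha> \<in> Inn G E"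
  then obtain g where g: "g \<in> E" "\<alpha> = conjm G g E" by (auto simp: Inn_def)
  \<comment> \<open>\<gamma> carries conjugation by g to conjugation by
    \<open>\<gamma> g\<close>.\<close>
  then have "compose E \<gamma> (compose E \<alpha> \<beta>) = conjm G (\<gamma> g) E"
    using bg by (auto simp: compose_def conjm_def fun_eq_iff)
  then show "compose E \<gamma> (compose E \<alpha> \<beta>) \<in> Inn G E" using g bg by (auto simp: Inn_def)
qed

text \<open>The image of Q in \<open>OutF\<close> is a normal p-subgroup of a group with a strongly
  p-embedded subgroup, hence trivial.\<close>

lemma normal_p_subgroup_Inn:
  assumes Q: "Q \<lhd> Aut" "card Q = p ^ k"
  shows "Q \<subseteq> Inn G E"
proof -
  interpret I: normal "Inn G E" Aut by (rule Inn_normal)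
  interpret Q: normal Q Aut by (rule Q(1))
  let ?O = "OutF G F E"
  interpret O: group ?O unfolding OutF_def by (rule I.factorgroup_is_group)
  let ?f = "\<lambda>a. Inn G E #>\<^bsub>Aut\<^esub> a"
  have hom: "?f \<in> hom Aut ?O" unfolding OutF_def by (rule I.r_coset_hom_Mod)
  have surj: "?f ` carrier Aut = carrier ?O" by (simp add: OutF_def carrier_FactGroup)
  have "group_hom Aut ?O ?f"
    by (simp add: group_hom_def group_hom_axioms_def group_Aut O.is_group hom)
  then have nrm: "?f ` Q \<lhd> ?O" using Q.surj_hom_normal_subgroup surj by blast
  have "?f \<in> hom (Aut\<lparr>carrier := Q\<rparr>) (?O\<lparr>carrier := ?f ` Q\<rparr>)"
    by (rule homI) (use hom_mult[OF hom] Q.subset in auto)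
  then interpret fQ: group_hom "Aut\<lparr>carrier := Q\<rparr>" "?O\<lparr>carrier := ?f ` Q\<rparr>" ?f
    using Aut.subgroup_imp_group[OF Q.subgroup_axioms]
      O.subgroup_imp_group[OF normal_imp_subgroup[OF nrm]]
    by (simp add: group_hom_def group_hom_axioms_def)
  have "card (?f ` Q) dvd p ^ k"
    using fQ.order_dvd_if_surj Q(2) by (simp add: order_def)
  then obtain j where j: "card (?f ` Q) = p ^ j" using divides_primepow_nat prime by blast
  obtain M where M: "strongly_p_embedded ?O p M" using ess by (auto simp: essential_def)
  have "finite (carrier ?O)" using finite_Aut by (simp flip: surj)
  then have "?f ` Q = {\<one>\<^bsub>?O\<^esub>}"
    by (rule O.strongly_p_embedded_normal_p_subgroup[OF _ prime M nrm j])
  then have "?f q = Inn G E" if "q \<in> Q" for q using that by (auto simp: OutF_def)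
  then show ?thesis
    using Aut.coset_join1[OF _ _ I.subgroup_axioms] subsetD[OF Q.subset] by (intro subsetI) simp
qed

lemma centralizer_le: "centralizer G E \<subseteq> E"
proof -
  \<comment> \<open>The inclusion of E in S is conjugation by \<open>\<one>\<close>, so E belongs to
    its own class and the condition C_S(P) \<le> P holds for P = E.\<close>
  have "conjm G \<one> E \<in> HomS G E (carrier G)" by (auto simp: HomS_def)
  then have "conjm G \<one> E \<in> F E (carrier G)"
    using fusion subgroup_E subgroup_self unfolding fusion_system_def by blast
  moreover have "conjm G \<one> E ` E = E" by (auto simp: conjm_def)
  ultimately have "E \<in> fclass G F E" unfolding fclass_def by blast
  then show ?thesis using ess by (auto simp: essential_def)
qed

text \<open>If g acts on E as some h in E does, then \<open>g \<otimes> inv h\<close> centralizes E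
  and so lies in E.\<close>

lemma conjm_Inn_imp_mem:
  assumes "g \<in> carrier G" "conjm G g E \<in> Inn G E"
  shows "g \<in> E"
proof -
  obtain h where h: "h \<in> E" "conjm G g E = conjm G h E" using assms by (auto simp: Inn_def)
  have "g \<otimes> inv h \<in> centralizer G E"
    unfolding centralizer_def
  proof (intro CollectI conjI ballI)
    fix x assume x: "x \<in> E"
    then have "inv g \<otimes> x \<otimes> g = inv h \<otimes> x \<otimes> h" using fun_cong[OF h(2), of x] by (simp add: conjm_def)
    then have "g \<otimes> (inv g \<otimes> x \<otimes> g) \<otimes> inv h = g \<otimes> (inv h \<otimes> x \<otimes> h) \<otimes> inv h" by simp
    moreover have "g \<otimes> (inv g \<otimes> x \<otimes> g) \<otimes> inv h = x \<otimes> (g \<otimes> inv h)"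
      using x h(1) assms(1) by (simp flip: m_assoc)
    moreover have "g \<otimes> (inv h \<otimes> x \<otimes> h) \<otimes> inv h = g \<otimes> inv h \<otimes> x"
      using x h(1) assms(1) by (simp add: m_assoc)
    ultimately show "g \<otimes> inv h \<otimes> x = x \<otimes> (g \<otimes> inv h)" by simp
  qed (use h assms in simp)
  then have "g \<otimes> inv h \<in> E" using centralizer_le by blast
  then have "g \<otimes> inv h \<otimes> h \<in> E" using h E_closed(1) by blast
  then show ?thesis using h assms by (simp add: m_assoc)
qed

end

section \<open>Automorphisms stabilizing a chain of subgroups\<close>

context frattini_central
begin

text \<open>A factor \<open>inv x \<otimes> f x\<close> in the central subgroup \<open>D\<close>
  moves past \<open>inv y\<close>, so these factors multiply along products. Later f is conjugation
  by an element of \<open>E0\<close>.\<close>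

lemma subgroup_moved_into_D:
  assumes "subgroup K G" "K \<subseteq> E" "\<And>x. x \<in> E \<Longrightarrow> f x \<in> E"
    and "\<And>x y. x \<in> E \<Longrightarrow> y \<in> E \<Longrightarrow> f (x \<otimes> y) = f x \<otimes> f y"
  shows "subgroup {z \<in> K. inv z \<otimes> f z \<in> D} G"
proof (rule subgroup_finite_closedI)
  have KE: "z \<in> E" if "z \<in> K" for z using assms(2) that by blast
  show "{z \<in> K. inv z \<otimes> f z \<in> D} \<subseteq> carrier G" using KE by auto
  show "finite {z \<in> K. inv z \<otimes> f z \<in> D}" using finite_subset[OF assms(2) finite_E] by simp
  have "f \<one> \<otimes> f \<one> = f \<one>" using assms(4)[of \<one> \<one>] by simp
  then have "f \<one> = \<one>" using assms(3)[of \<one>] by simp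
  then show "\<one> \<in> {z \<in> K. inv z \<otimes> f z \<in> D}" using subgroup.one_closed[OF assms(1)] by simp
  fix x y assume x: "x \<in> {z \<in> K. inv z \<otimes> f z \<in> D}" and y: "y \<in> {z \<in> K. inv z \<otimes> f z \<in> D}"
  have xE: "x \<in> E" "f x \<in> E" and yE: "y \<in> E" "f y \<in> E" using x y KE assms(3) by auto
  have "inv (x \<otimes> y) \<otimes> f (x \<otimes> y) = inv y \<otimes> (inv x \<otimes> f x) \<otimes> f y"
    using xE yE assms(4) by (simp add: inv_mult_group m_assoc)
  also have "inv y \<otimes> (inv x \<otimes> f x) = (inv x \<otimes> f x) \<otimes> inv y"
    using x yE by (intro central[symmetric]) auto
  also have "inv x \<otimes> f x \<otimes> inv y \<otimes> f y = (inv x \<otimes> f x) \<otimes> (inv y \<otimes> f y)"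
    using xE yE by (simp add: m_assoc)
  finally have "inv (x \<otimes> y) \<otimes> f (x \<otimes> y) \<in> D" using x y by simp
  then show "x \<otimes> y \<in> {z \<in> K. inv z \<otimes> f z \<in> D}" using x y subgroup.m_closed[OF assms(1)] by simp
qed

end

context essential_frattini_central
begin

lemma aut_pow: "\<beta> \<in> F E E \<Longrightarrow> x \<in> E \<Longrightarrow> \<beta> (x [^] (n::nat)) = \<beta> x [^] n"
  by (induction n) auto

text \<open>The automorphisms in \<open>F E E\<close> acting trivially on E/L and on L/D form a set
  Q. It is a normal subgroup because L and \<open>D\<close> are invariant, and a p-group by coprime
  action, so \<open>normal_p_subgroup_Inn\<close> applies.\<close>

lemma chain_stabilizer_Inn:
  assumes L: "subgroup L G" "D \<subseteq> L" "L \<subseteq> E" "\<And>\<beta> x. \<beta> \<in> F E E \<Longrightarrow> x \<in> L \<Longrightarrow> \<beta> x \<in> L"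
    and \<beta>: "\<beta> \<in> F E E" "\<And>x. x \<in> E \<Longrightarrow> inv x \<otimes> \<beta> x \<in> L" "\<And>x. x \<in> L \<Longrightarrow> inv x \<otimes> \<beta> x \<in> D"
  shows "\<beta> \<in> Inn G E"
proof -
  define Q where "Q = {\<beta> \<in> F E E. (\<forall>x\<in>E. inv x \<otimes> \<beta> x \<in> L) \<and> (\<forall>x\<in>L. inv x \<otimes> \<beta> x \<in> D)}"
  have LE [simp]: "x \<in> E" if "x \<in> L" for x using that L(3) by blast
  note Lcl = subgroup.m_closed[OF L(1)] subgroup.one_closed[OF L(1)] subgroup.m_inv_closed[OF L(1)]
  interpret Aut: group Aut by (rule group_Aut)
  have nrm: "Q \<lhd> Aut"
  proof (rule Aut_normalI)
    show "Q \<subseteq> F E E" by (auto simp: Q_def)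
    show "\<one>\<^bsub>Aut\<^esub> \<in> Q" using Aut.one_closed Lcl by (auto simp: Q_def)
  next
    fix \<alpha> \<beta> assume ab: "\<alpha> \<in> Q" "\<beta> \<in> Q"
    have "compose E \<beta> \<alpha> \<in> F E E" using Aut.m_closed[of \<alpha> \<beta>] ab by (simp add: Q_def)
    moreover have "inv x \<otimes> \<beta> (\<alpha> x) = (inv x \<otimes> \<alpha> x) \<otimes> (inv (\<alpha> x) \<otimes> \<beta> (\<alpha> x))" if "x \<in> E" for x
    proof -
      have "x \<in> carrier G" "\<alpha> x \<in> carrier G" "\<beta> (\<alpha> x) \<in> carrier G"
        using that ab by (auto simp: Q_def)
      then show ?thesis by (simp add: m_assoc) (simp flip: m_assoc)
    qed
    ultimately show "compose E \<beta> \<alpha> \<in> Q" using ab Lcl L(4)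
      by (auto simp: Q_def compose_def)
  next
    fix \<beta> \<gamma> \<alpha> assume bg: "\<beta> \<in> F E E" "\<gamma> \<in> F E E" "\<And>x. x \<in> E \<Longrightarrow> \<gamma> (\<beta> x) = x" and a: "\<alpha> \<in> Q"
    have aF: "\<alpha> \<in> F E E" using a by (simp add: Q_def)
    have "compose E \<gamma> (compose E \<alpha> \<beta>) \<in> F E E"
      using Aut.m_closed[OF Aut.m_closed, of \<beta> \<alpha> \<gamma>] bg aF by simp
    \<comment> \<open>Conjugating \<alpha> replaces its displacement at \<open>\<beta> x\<close> by
      the image under \<gamma>, which preserves both L and \<open>D\<close>.\<close>
    moreover have eq: "inv x \<otimes> \<gamma> (\<alpha> (\<beta> x)) = \<gamma> (inv (\<beta> x) \<otimes> \<alpha> (\<beta> x))" if "x \<in> E" for x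
      using that bg aF by simp
    moreover have "inv x \<otimes> \<gamma> (\<alpha> (\<beta> x)) \<in> L" if "x \<in> E" for x
      unfolding eq[OF that] by (rule L(4)[OF bg(2)]) (use that a bg(1) in \<open>simp add: Q_def\<close>)
    moreover have "inv x \<otimes> \<gamma> (\<alpha> (\<beta> x)) \<in> D" if "x \<in> L" for x
      unfolding eq[OF LE[OF that]]
      by (rule aut_D[OF bg(2)]) (use that a L(4)[OF bg(1) that] in \<open>simp add: Q_def\<close>)
    ultimately show "compose E \<gamma> (compose E \<alpha> \<beta>) \<in> Q"
      by (simp add: Q_def compose_def)
  qed
  then have Qsub: "subgroup Q Aut" by (rule normal_imp_subgroup)
  have finQ: "finite Q" using finite_subset[OF _ finite_Aut] by (simp add: Q_def)
  have "\<exists>k. card Q = p ^ k"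
  proof (rule prime_power_if_unique_prime_divisor)
    have "\<beta> \<in> Q" using \<beta> by (simp add: Q_def)
    then show "0 < card Q" using finQ by (auto simp: card_gt_0_iff)
    fix q :: nat assume q: "Factorial_Ring.prime q" "q dvd card Q"
    show "q = p"
    proof (rule ccontr)
      assume "q \<noteq> p"
      \<comment> \<open>A subgroup R of order q fixes a point in every coset of L in E and of D in L, since these
        have p-power size. So the fixed points of R generate E modulo D, hence E.\<close>
      interpret Qg: group "Aut\<lparr>carrier := Q\<rparr>" by (rule Aut.subgroup_imp_group[OF Qsub])
      obtain m where "card Q = q * m" using q by blast
      then obtain R where R: "subgroup R (Aut\<lparr>carrier := Q\<rparr>)" "card R = q"
        using sylow_thm[OF q(1) Qg.is_group, of 1 m] finQ by (auto simp: order_def)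
      have RQ: "R \<subseteq> Q" using subgroup.subset[OF R(1)] by simp
      have RA: "subgroup R Aut" using Aut.incl_subgroup[OF Qsub R(1)] .
      interpret Rg: group "Aut\<lparr>carrier := R\<rparr>" by (rule Aut.subgroup_imp_group[OF RA])
      have RF: "\<beta> \<in> F E E" if "\<beta> \<in> R" for \<beta> using that RQ by (auto simp: Q_def)
      have RL: "inv x \<otimes> \<beta> x \<in> L" if "\<beta> \<in> R" "x \<in> E" for \<beta> x
        using that RQ by (auto simp: Q_def)
      have RD: "inv x \<otimes> \<beta> x \<in> D" if "\<beta> \<in> R" "x \<in> L" for \<beta> x
        using that RQ by (auto simp: Q_def)
      \<comment> \<open>Used with Y = L and then with Y = \<open>D\<close>. R permutes the coset x Y
        because each \<beta> moves x within x Y.\<close>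
      have fix_coset: "\<exists>y\<in>Y. \<forall>\<beta>\<in>R. \<beta> (x \<otimes> y) = x \<otimes> y"
        if Y: "subgroup Y G" "Y \<subseteq> E" "\<And>\<beta> y. \<beta> \<in> R \<Longrightarrow> y \<in> Y \<Longrightarrow> \<beta> y \<in> Y"
          and x: "x \<in> E" "\<And>\<beta>. \<beta> \<in> R \<Longrightarrow> inv x \<otimes> \<beta> x \<in> Y" for x Y
      proof -
        let ?X = "(\<lambda>y. x \<otimes> y) ` Y"
        have YE: "y \<in> E" if "y \<in> Y" for y using that Y(2) by blast
        have XE: "z \<in> E" if "z \<in> ?X" for z using that YE x by auto
        have inj: "inj_on (\<lambda>y. x \<otimes> y) Y" using YE x(1) by (intro inj_onI) simp
        obtain n where "card E = p ^ n" using p_power by blast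
        then obtain i where "card Y = p ^ i"
          using p_group_subgroup_card[OF is_group prime Y(1) subgroup_E Y(2)] by blast
        then have cX: "card ?X = p ^ i" using card_image[OF inj] by simp
        have "card ?X mod q = card {z \<in> ?X. \<forall>\<beta>\<in>carrier (Aut\<lparr>carrier := R\<rparr>). \<beta> z = z} mod q"
        proof (rule Rg.fixed_points_cong[OF q(1), of 1])
          show "finite ?X" using finite_subset[OF Y(2) finite_E] by simp
          fix \<beta> z assume b: "\<beta> \<in> carrier (Aut\<lparr>carrier := R\<rparr>)" and z: "z \<in> ?X"
          then obtain y where y: "z = x \<otimes> y" "y \<in> Y" by blast
          have bF: "\<beta> \<in> F E E" using b RF by simp
          have "\<beta> z = x \<otimes> ((inv x \<otimes> \<beta> x) \<otimes> \<beta> y)"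
          proof -
            have "x \<in> carrier G" "\<beta> x \<in> carrier G" "\<beta> y \<in> carrier G" using x y YE bF by auto
            moreover have "\<beta> z = \<beta> x \<otimes> \<beta> y" using bF x y YE by simp
            ultimately show ?thesis by (simp flip: m_assoc)
          qed
          moreover have "(inv x \<otimes> \<beta> x) \<otimes> \<beta> y \<in> Y"
            using b x(2) Y(3) y(2) subgroup.m_closed[OF Y(1)] by simp
          ultimately show "\<beta> z \<in> ?X" by blast
        qed (use R(2) XE in \<open>auto simp: order_def compose_def\<close>)
        moreover have "\<not> q dvd p ^ i"
          using q(1) prime \<open>q \<noteq> p\<close> by (metis prime_dvd_power primes_dvd_imp_eq)
        ultimately have "{z \<in> ?X. \<forall>\<beta>\<in>carrier (Aut\<lparr>carrier := R\<rparr>). \<beta> z = z} \<noteq> {}"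
          using cX by (metis card.empty dvd_eq_mod_eq_0 mod_0)
        then show ?thesis by auto
      qed
      let ?K = "{z \<in> E. \<forall>\<beta>\<in>R. \<beta> z = z}"
      have K: "subgroup ?K G"
        by (rule subgroup_finite_closedI) (use finite_E RF in auto)
      have "E \<subseteq> {k \<otimes> d | k d. k \<in> ?K \<and> d \<in> D}"
      proof
        fix x assume x: "x \<in> E"
        have "\<exists>l\<in>L. \<forall>\<beta>\<in>R. \<beta> (x \<otimes> l) = x \<otimes> l"
          by (rule fix_coset[OF L(1,3) _ x]) (use L(4) RF RL x in blast)+
        then obtain l where l: "l \<in> L" "\<forall>\<beta>\<in>R. \<beta> (x \<otimes> l) = x \<otimes> l" by blast
        \<comment> \<open>Starting from \<open>inv l\<close> makes the product of the two fixed
          points equal to \<open>x \<otimes> d\<close>, which agrees with x modulo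
          \<open>D\<close>.\<close>
        have "\<exists>d\<in>D. \<forall>\<beta>\<in>R. \<beta> (inv l \<otimes> d) = inv l \<otimes> d"
          by (rule fix_coset[OF subgroup_D pfrat_subset[OF subgroup_E]])
            (use aut_D RF RD Lcl(3)[OF l(1)] LE in blast)+
        then obtain d where d: "d \<in> D" "\<forall>\<beta>\<in>R. \<beta> (inv l \<otimes> d) = inv l \<otimes> d" by blast
        have lE: "l \<in> E" "d \<in> E" using l d by auto
        have "x = ((x \<otimes> l) \<otimes> (inv l \<otimes> d)) \<otimes> inv d"
        proof -
          have "x \<in> carrier G" "l \<in> carrier G" "d \<in> carrier G" using x lE by auto
          moreover from this have "(x \<otimes> l) \<otimes> (inv l \<otimes> d) = x \<otimes> (l \<otimes> inv l) \<otimes> d" by (simp only: m_assoc m_closed inv_closed)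
          ultimately show ?thesis by (simp add: m_assoc)
        qed
        moreover have "(x \<otimes> l) \<otimes> (inv l \<otimes> d) \<in> ?K"
        proof (rule subgroup.m_closed[OF K])
          show "x \<otimes> l \<in> ?K" using x lE l(2) E_closed(1) by blast
          show "inv l \<otimes> d \<in> ?K" using lE d(2) E_closed(1,2) by blast
        qed
        ultimately show "x \<in> {k \<otimes> d | k d. k \<in> ?K \<and> d \<in> D}" using d(1) D_closed(2) by blast
      qed
      then have "?K = E" by (intro nongenerators K) auto
      have "R \<subseteq> {\<one>\<^bsub>Aut\<^esub>}"
      proof
        fix \<beta> assume b: "\<beta> \<in> R"
        have "\<beta> x = x" if "x \<in> E" for x using b that \<open>?K = E\<close> by blast
        then show "\<beta> \<in> {\<one>\<^bsub>Aut\<^esub>}"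
          using aut_extensional[OF RF[OF b]] by (auto simp: fun_eq_iff extensional_def)
      qed
      then have "card R \<le> 1" using card_mono[of "{\<one>\<^bsub>Aut\<^esub>}" R] by simp
      then show False using R(2) prime_gt_1_nat[OF q(1)] by simp
    qed
  qed
  then obtain k where "card Q = p ^ k" by blast
  then have "Q \<subseteq> Inn G E" using normal_p_subgroup_Inn nrm by blast
  then show ?thesis using \<beta> by (auto simp: Q_def)
qed

text \<open>Conjugation by g is inner by the chain argument, and C_S(E) \<le> E puts g into E. With
  L = \<open>D\<close> it says that an element normalizing E and acting trivially on E/D lies in
  E.\<close>

lemma chain_stabilizer_conj_mem:
  assumes L: "subgroup L G" "D \<subseteq> L" "L \<subseteq> E" "\<And>\<beta> x. \<beta> \<in> F E E \<Longrightarrow> x \<in> L \<Longrightarrow> \<beta> x \<in> L"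
    and g: "g \<in> carrier G" "\<And>x. x \<in> E \<Longrightarrow> inv g \<otimes> x \<otimes> g \<in> E"
    and "\<And>x. x \<in> E \<Longrightarrow> inv x \<otimes> (inv g \<otimes> x \<otimes> g) \<in> L"
    and "\<And>x. x \<in> L \<Longrightarrow> inv x \<otimes> (inv g \<otimes> x \<otimes> g) \<in> D"
  shows "g \<in> E"
proof (rule conjm_Inn_imp_mem[OF g(1)], rule chain_stabilizer_Inn[OF L(1-3)])
  show "\<And>\<beta> x. \<beta> \<in> F E E \<Longrightarrow> x \<in> L \<Longrightarrow> \<beta> x \<in> L" by (rule L(4))
  show "conjm G g E \<in> F E E" by (rule conjm_Aut[OF g])
  show "inv x \<otimes> conjm G g E x \<in> L" if "x \<in> E" for x using that assms(7) by (simp add: conjm_def)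
  show "inv x \<otimes> conjm G g E x \<in> D" if "x \<in> L" for x
    using that assms(8) L(3) by (auto simp: conjm_def)
qed

end

section \<open>The exponent of E\<close>

context essential_frattini_central
begin

text \<open>\<open>E0\<close> is meant as the image of E under an automorphism of N_S(E) that moves
  E, and the assumptions record what this automorphism transports. \<open>exp_D0\<close> is
  conditional because the exponent of \<open>D\<close> is settled only in the course of the
  proof.\<close>

lemma exponent_p_if_other_normal:
  assumes E0: "frattini_central G p E0" and card_E0: "card E0 = card E" and ne: "E0 \<noteq> E"
    and nE: "\<And>g x. g \<in> E0 \<Longrightarrow> x \<in> E \<Longrightarrow> inv g \<otimes> x \<otimes> g \<in> E"
    and nE0: "\<And>g x. g \<in> E \<Longrightarrow> x \<in> E0 \<Longrightarrow> inv g \<otimes> x \<otimes> g \<in> E0"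
    and card_D: "card E = p * p * card D"
    and card_D0: "card (pfrat G p E0) = card D"
    and exp_D0: "\<And>x. (\<And>d. d \<in> D \<Longrightarrow> d [^] p = \<one>) \<Longrightarrow> x \<in> pfrat G p E0 \<Longrightarrow> x [^] p = \<one>"
    and x: "x \<in> E"
  shows "x [^] p = \<one>"
proof -
  interpret E0: frattini_central G p E0 by (rule E0)
  have p1: "1 < p" using prime prime_gt_1_nat by blast
  \<comment> \<open>Conjugation as a total function, since it acts on E, on \<open>E0\<close> and on
    cosets of \<open>D\<close>.\<close>
  define cj where "cj g x = inv g \<otimes> x \<otimes> g" for g x
  have cj_mult: "cj g (x \<otimes> y) = cj g x \<otimes> cj g y"
    if "g \<in> carrier G" "x \<in> carrier G" "y \<in> carrier G" for g x y
  proof -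
    have "cj g x \<otimes> cj g y = inv g \<otimes> x \<otimes> (g \<otimes> inv g) \<otimes> y \<otimes> g"
      using that unfolding cj_def by (simp only: m_assoc m_closed inv_closed)
    then show ?thesis using that by (simp add: cj_def m_assoc)
  qed
  have cj_closed [simp]: "cj g x \<in> carrier G" if "g \<in> carrier G" "x \<in> carrier G" for g x
    using that by (simp add: cj_def)
  have cj_comp: "cj (g \<otimes> h) x = cj h (cj g x)"
    if "g \<in> carrier G" "h \<in> carrier G" "x \<in> carrier G" for g h x
    using that by (simp add: cj_def inv_mult_group m_assoc)
  have cj_one: "cj \<one> x = x" if "x \<in> carrier G" for x using that by (simp add: cj_def)
  have cj_pow: "cj g (x [^] n) = cj g x [^] n" if "g \<in> carrier G" "x \<in> carrier G" for g x and n :: nat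
    by (induction n) (use that in \<open>simp_all add: cj_mult, simp add: cj_def\<close>)
  have cj_E: "cj g x \<in> E" if "g \<in> E0" "x \<in> E" for g x using nE that by (simp add: cj_def)
  have cj_E0: "cj g x \<in> E0" if "g \<in> E0" "x \<in> E0" for g x using that by (simp add: cj_def)
  have cj_D: "cj g d \<in> D" if g: "g \<in> E0" and d: "d \<in> D" for g d
  proof -
    have "conjm G g E \<in> F E E" by (rule conjm_Aut) (use g nE in auto)
    from aut_D[OF this d] show ?thesis using d by (simp add: conjm_def cj_def)
  qed

  define I where "I = E \<inter> E0"
  have I: "subgroup I G" "I \<subseteq> E" "I \<subseteq> E0"
    unfolding I_def using subgroups_Inter_pair subgroup_E E0.subgroup_E by auto
  have I_E: "x \<in> E" "x \<in> E0" if "x \<in> I" for x using that by (auto simp: I_def)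
  have finI: "finite I" using finite_subset[OF I(2) finite_E] .
  have cj_I: "cj g x \<in> I" if "g \<in> E0" "x \<in> I" for g x
    using that cj_E cj_E0 by (auto simp: I_def)
  \<comment> \<open>The commutator [x, g] lies in E since g normalizes E, and in \<open>E0\<close>
    since x normalizes \<open>E0\<close>.\<close>
  have comm_I: "inv x \<otimes> cj g x \<in> I" if x: "x \<in> E" and g: "g \<in> E0" for x g
  proof -
    have "inv x \<otimes> cj g x \<in> E" using cj_E x g by simp
    moreover have "inv x \<otimes> cj g x = (inv x \<otimes> inv g \<otimes> x) \<otimes> g"
      using x g by (simp add: cj_def m_assoc)
    moreover have "(inv x \<otimes> inv g \<otimes> x) \<otimes> g \<in> E0" using nE0[of x "inv g"] x g by simp
    ultimately show ?thesis by (simp add: I_def)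
  qed
  \<comment> \<open>L turns out to be I; adding D makes it contain D from the start.\<close>
  define L where "L = {k \<otimes> d | k d. k \<in> I \<and> d \<in> D}"
  have L: "subgroup L G" unfolding L_def using I by (intro subgroup_mult_D)
  have LE: "L \<subseteq> E" using I by (auto simp: L_def)
  have L_E: "x \<in> E" if "x \<in> L" for x using that LE by blast
  have DL: "D \<subseteq> L"
  proof
    fix d assume "d \<in> D"
    then have "d = \<one> \<otimes> d" by simp
    then show "d \<in> L" using subgroup.one_closed[OF I(1)] \<open>d \<in> D\<close> unfolding L_def by blast
  qed
  have IL: "I \<subseteq> L"
  proof
    fix k assume k: "k \<in> I"
    then have "k = k \<otimes> \<one>" using I_E by simp
    then show "k \<in> L" using k D_closed(3) unfolding L_def by blast
  qed
  have finL: "finite L" using finite_subset[OF LE finite_E] .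
  \<comment> \<open>The chain argument with L = \<open>D\<close>.\<close>
  have faithful: "g \<in> E" if g: "g \<in> E0" "\<And>x. x \<in> E \<Longrightarrow> inv x \<otimes> cj g x \<in> D" for g
    by (rule chain_stabilizer_conj_mem[OF subgroup_D])
      (use g nE cj_D aut_D in \<open>auto simp: cj_def\<close>)
  have "\<not> E0 \<subseteq> E" using card_subset_eq[OF finite_E] card_E0 ne by blast
  then obtain g0 where g0: "g0 \<in> E0" "g0 \<notin> E" by blast
  \<comment> \<open>Otherwise every [x, g0] would lie in \<open>D\<close>, so g0 would act trivially
    on E/D and lie in E.\<close>
  have "L \<noteq> D"
  proof
    assume "L = D"
    then have "inv x \<otimes> cj g0 x \<in> D" if "x \<in> E" for x using comm_I[OF that g0(1)] IL by blast
    then show False using faithful g0 by blast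
  qed
  \<comment> \<open>If I and \<open>D\<close> together gave E, then I = E by nongeneration, so E
    \<le> \<open>E0\<close> with equal orders.\<close>
  have "L \<noteq> E"
  proof
    assume "L = E"
    then have "I = E" by (intro nongenerators I) (auto simp: L_def)
    then have "E = E0" using card_subset_eq[OF E0.finite_E, of E] card_E0 I by auto
    then show False using ne by simp
  qed
  \<comment> \<open>Since D < L < E and |E : D| = p^2, both steps have index p.\<close>
  obtain n where n: "card E = p ^ n" using p_power by blast
  obtain k where k: "card D = p ^ k" using card_D_power by blast
  obtain i where i: "card L = p ^ i"
    using p_group_subgroup_card[OF is_group prime L subgroup_E LE n] by blast
  have "card D < card L" using psubset_card_mono[OF finL] DL \<open>L \<noteq> D\<close> by blast
  then have "k < i" using k i p1 by simp
  have "card L < card E" using psubset_card_mono[OF finite_E] LE \<open>L \<noteq> E\<close> by blast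
  then have "p ^ i < p ^ (k + 2)" using k i card_D by (simp add: power_add power2_eq_square mult_ac)
  then have "i < k + 2" using p1 power_less_imp_less_exp by blast
  with \<open>k < i\<close> have "i = Suc k" by simp
  then have card_L: "card L = p * card D" "card E = p * card L" using k i card_D by auto

  \<comment> \<open>The p-group \<open>E0\<close> acts on L/D, which has order p, and fixes the
    trivial coset, hence a second one. The elements of L whose coset is fixed form a subgroup
    strictly above \<open>D\<close>, hence all of L.\<close>
  have comm_L: "inv x \<otimes> cj g x \<in> D" if "x \<in> L" "g \<in> E0" for x g
  proof -
    interpret E0g: group "G\<lparr>carrier := E0\<rparr>" by (rule subgroup_imp_group[OF E0.subgroup_E])
    have cj_L: "cj g x \<in> L" if g: "g \<in> E0" and x: "x \<in> L" for g x
    proof -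
      obtain k d where kd: "x = k \<otimes> d" "k \<in> I" "d \<in> D" using x unfolding L_def by blast
      then have "cj g x = cj g k \<otimes> cj g d" using g I_E by (simp add: cj_mult)
      then show ?thesis using cj_I[OF g kd(2)] cj_D[OF g kd(3)] unfolding L_def by blast
    qed
    have img: "cj g ` (D #> x) = D #> cj g x" if g: "g \<in> E0" and x: "x \<in> L" for g x
    proof
      have xG: "x \<in> carrier G" "g \<in> carrier G" using x g L_E by auto
      show "cj g ` (D #> x) \<subseteq> D #> cj g x"
        using xG cj_D[OF g] by (auto simp: r_coset_def cj_mult)
      show "D #> cj g x \<subseteq> cj g ` (D #> x)"
      proof
        fix y assume "y \<in> D #> cj g x"
        then obtain d where d: "d \<in> D" "y = d \<otimes> cj g x" by (auto simp: r_coset_def)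
        have "cj g (cj (inv g) d) = d" using d(1) g cj_comp[of "inv g" g d] cj_one by simp
        then have "y = cj g (cj (inv g) d \<otimes> x)" using d xG by (simp add: cj_mult)
        moreover have "cj (inv g) d \<in> D" using cj_D d g by simp
        ultimately show "y \<in> cj g ` (D #> x)" by (auto simp: r_coset_def)
      qed
    qed
    let ?X = "(\<lambda>x. D #> x) ` L"
    have "card ?X * card D = card L"
      by (rule card_rcosets_in_subgroup[OF subgroup_D L DL finL])
    moreover have "0 < card D" using k p1 by simp
    ultimately have cX: "card ?X = p" using card_L by simp
    have DG: "D \<subseteq> carrier G" by auto
    obtain m where m: "card E0 = p ^ m" using E0.p_power by blast
    have act: "(\<lambda>c. cj g c) ` C \<in> ?X" if "g \<in> E0" "C \<in> ?X" for g C
      using that img cj_L by (auto simp del: image_image)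
    have XG: "C \<subseteq> carrier G" if "C \<in> ?X" for C using that L_E DG by (auto simp: r_coset_def)
    have DX: "D = D #> \<one>" using DG by simp
    obtain C where C: "C \<in> ?X" "C \<noteq> D" "\<And>g. g \<in> E0 \<Longrightarrow> cj g ` C = C"
    proof (rule E0g.fixed_point_exists[of p m ?X D "\<lambda>g C. cj g ` C"])
      show "order (G\<lparr>carrier := E0\<rparr>) = p ^ m" using m by (simp add: order_def)
      show "D \<in> ?X" using DX subgroup.one_closed[OF L] by (rule image_eqI)
      fix g assume g: "g \<in> carrier (G\<lparr>carrier := E0\<rparr>)"
      show "cj g ` D = D" using img[of g \<one>] g DX subgroup.one_closed[OF L] by (simp add: cj_def)
    next
      fix C assume "C \<in> ?X"
      have "cj \<one> ` C = (\<lambda>x. x) ` C" by (rule image_cong) (use XG[OF \<open>C \<in> ?X\<close>] cj_one in auto)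
      then show "cj \<one>\<^bsub>G\<lparr>carrier := E0\<rparr>\<^esub> ` C = C" by simp
      fix g h assume "g \<in> carrier (G\<lparr>carrier := E0\<rparr>)" "h \<in> carrier (G\<lparr>carrier := E0\<rparr>)"
      then show "cj (g \<otimes>\<^bsub>G\<lparr>carrier := E0\<rparr>\<^esub> h) ` C = cj h ` (cj g ` C)"
        unfolding image_image by (intro image_cong) (use XG[OF \<open>C \<in> ?X\<close>] cj_comp in auto)
    qed (use prime finL cX act in auto)
    then obtain z where z: "z \<in> L" "C = D #> z" by blast
    have zE: "z \<in> E" using z L_E by blast
    have "z \<notin> D" using C(2) z coset_join2[OF _ subgroup_D] by auto
    let ?S = "{z \<in> L. \<forall>g\<in>E0. inv z \<otimes> cj g z \<in> D}"
    \<comment> \<open>As an intersection over g, \<open>?S\<close> is a subgroup by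
      \<open>subgroup_moved_into_D\<close> applied to each g.\<close>
    have S: "?S = (\<Inter>g\<in>E0. {z \<in> L. inv z \<otimes> cj g z \<in> D})" using E0.E_closed(3) by blast
    have "subgroup ?S G"
      unfolding S
    proof (rule subgroups_Inter)
      show "(\<lambda>g. {z \<in> L. inv z \<otimes> cj g z \<in> D}) ` E0 \<noteq> {}" using E0.E_closed(3) by blast
      fix H assume "H \<in> (\<lambda>g. {z \<in> L. inv z \<otimes> cj g z \<in> D}) ` E0"
      then obtain g where g: "g \<in> E0" "H = {z \<in> L. inv z \<otimes> cj g z \<in> D}" by blast
      show "subgroup H G"
        unfolding g(2) using L LE cj_E[OF g(1)] g(1) by (intro subgroup_moved_into_D) (auto simp: cj_mult)
    qed
    moreover have "D \<subseteq> ?S" using DL cj_D by auto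
    ultimately have "?S = D \<or> ?S = L"
      using subgroup_between_prime_index[OF subgroup_D _ L _ _ finL prime card_L(1)] by blast
    moreover have "z \<in> ?S"
    proof (intro CollectI conjI ballI)
      show "z \<in> L" by (rule z(1))
      fix g assume g: "g \<in> E0"
      have "cj g z \<in> D #> z"
        using C(3)[OF g] img[OF g z(1)] z rcos_self[OF _ subgroup_D, of "cj g z"] zE g by auto
      then obtain d where d: "d \<in> D" "cj g z = d \<otimes> z" by (auto simp: r_coset_def)
      have "inv z \<otimes> (d \<otimes> z) = inv z \<otimes> (z \<otimes> d)" using central[OF d(1) zE] by simp
      also have "\<dots> = d" using d(1) zE by (simp flip: m_assoc)
      finally show "inv z \<otimes> cj g z \<in> D" using d by simp
    qed
    ultimately have "?S = L" using \<open>z \<notin> D\<close> by blast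
    then show ?thesis using that by blast
  qed

  have "I = L"
  proof (rule card_seteq[OF finL IL])
    \<comment> \<open>An element of \<open>E\<^sub>0\<close> is determined modulo I by the coset D[a, g] for a fixed a outside L, so
      |\<open>E\<^sub>0\<close> : I| is at most |L : D| = p.\<close>
    obtain a where a: "a \<in> E" "a \<notin> L" using LE \<open>L \<noteq> E\<close> by blast
    let ?X = "(\<lambda>x. D #> x) ` L"
    have "card ?X * card D = card L"
      by (rule card_rcosets_in_subgroup[OF subgroup_D L DL finL])
    moreover have "0 < card D" using k p1 by simp
    ultimately have cX: "card ?X = p" using card_L by simp
    define f where "f g = D #> (inv a \<otimes> cj g a)" for g
    have fX: "f ` E0 \<subseteq> ?X" using comm_I[OF a(1)] IL unfolding f_def by blast
    have inj: "I #> g = I #> h" if gh: "g \<in> E0" "h \<in> E0" "f g = f h" for g h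
    proof -
      let ?k = "g \<otimes> inv h"
      have kE0: "?k \<in> E0" using gh by simp
      have G: "g \<in> carrier G" "h \<in> carrier G" "a \<in> carrier G" using gh a by auto
      have "inv a \<otimes> cj g a \<in> D #> (inv a \<otimes> cj h a)"
        using gh(3) rcos_self[OF _ subgroup_D, of "inv a \<otimes> cj g a"] G unfolding f_def by simp
      then obtain d where d: "d \<in> D" "inv a \<otimes> cj g a = d \<otimes> (inv a \<otimes> cj h a)"
        by (auto simp: r_coset_def)
      have dG: "d \<in> carrier G" using d by simp
      have "cj g a = a \<otimes> (inv a \<otimes> cj g a)" using G by (simp flip: m_assoc)
      also have "\<dots> = (a \<otimes> d) \<otimes> inv a \<otimes> cj h a" unfolding d(2) using G dG by (simp add: m_assoc)
      also have "a \<otimes> d = d \<otimes> a" using central[OF d(1) a(1)] by simp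
      also have "d \<otimes> a \<otimes> inv a \<otimes> cj h a = d \<otimes> cj h a" using G dG by (simp add: m_assoc)
      finally have "cj ?k a = cj (inv h) (d \<otimes> cj h a)" using G by (simp add: cj_comp)
      also have "\<dots> = cj (inv h) d \<otimes> a"
        using G dG cj_comp[of h "inv h" a] by (simp add: cj_mult cj_one)
      finally have ck: "cj ?k a = cj (inv h) d \<otimes> a" .
      have d': "cj (inv h) d \<in> D" using cj_D gh d by simp
      have "inv a \<otimes> cj ?k a = inv a \<otimes> (a \<otimes> cj (inv h) d)" using ck central[OF d' a(1)] by simp
      also have "\<dots> = cj (inv h) d" using G dG by (simp flip: m_assoc)
      finally have ak: "inv a \<otimes> cj ?k a \<in> D" using d' by simp
      \<comment> \<open>The elements that \<open>?k\<close> moves within their coset of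
        \<open>D\<close> form a subgroup. It contains L by \<open>comm_L\<close>, and also a, which
        is outside L; so it is E and \<open>faithful\<close> puts \<open>?k\<close> into E.\<close>
      let ?S = "{z \<in> E. inv z \<otimes> cj ?k z \<in> D}"
      have "subgroup ?S G"
        using subgroup_E cj_E[OF kE0] kE0 by (intro subgroup_moved_into_D) (auto simp: cj_mult)
      moreover have "L \<subseteq> ?S" using comm_L kE0 LE by blast
      ultimately have "?S = L \<or> ?S = E"
        using subgroup_between_prime_index[OF L _ subgroup_E _ _ finite_E prime card_L(2)] by blast
      then have "?S = E" using a ak by blast
      then have "?k \<in> E" using faithful[OF kE0] by blast
      then have "?k \<in> I" using kE0 by (simp add: I_def)
      then have "I #> ?k = I" using coset_join2[OF _ I(1)] G by simp
      then show ?thesis using coset_mult_inv1 G subgroup.subset[OF I(1)] by blast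
    qed
    let ?Y = "(\<lambda>x. I #> x) ` E0"
    \<comment> \<open>One representative for each value of f meets every coset of I, so there are at
      most as many cosets as values.\<close>
    have "?Y \<subseteq> (\<lambda>C. I #> inv_into E0 f C) ` (f ` E0)"
    proof
      fix C assume "C \<in> ?Y"
      then obtain g where g: "g \<in> E0" "C = I #> g" by blast
      have "inv_into E0 f (f g) \<in> E0" "f (inv_into E0 f (f g)) = f g"
        using inv_into_into[of "f g" f E0] f_inv_into_f[of "f g" f E0] g(1) by simp_all
      then have "C = I #> inv_into E0 f (f g)" using inj g by blast
      then show "C \<in> (\<lambda>C. I #> inv_into E0 f C) ` (f ` E0)" using g by blast
    qed
    then have "card ?Y \<le> card (f ` E0)" using E0.finite_E by (intro surj_card_le) auto
    also have "\<dots> \<le> p" using card_mono[OF _ fX] finL cX by simp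
    finally have "card ?Y \<le> p" .
    moreover have "card ?Y * card I = card E0"
      by (rule card_rcosets_in_subgroup[OF I(1) E0.subgroup_E I(3) E0.finite_E])
    ultimately have "p * card L \<le> p * card I" using card_E0 card_L(2) by (metis mult_le_mono1)
    then show "card L \<le> card I" using p1 by simp
  qed
  \<comment> \<open>I = L is normal of index p in \<open>E0\<close>, so it contains the p-th powers
    and commutators of \<open>E0\<close>.\<close>
  have D0L: "pfrat G p E0 \<subseteq> L"
  proof (rule pfrat_leI[OF L])
    have cE0: "card E0 = p * card I" using card_L card_E0 \<open>I = L\<close> by simp
    have nrm: "x \<otimes> m \<otimes> inv x \<in> I" if "x \<in> E0" "m \<in> I" for x m
      using cj_I[of "inv x" m] that by (simp add: cj_def)
    show "x [^] p \<in> L" if "x \<in> E0" for x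
      using index_p_pow_commutator(1)[OF I(1) E0.subgroup_E I(3) E0.finite_E prime cE0 nrm that that]
        \<open>I = L\<close> by simp
    show "x \<otimes> y \<otimes> inv x \<otimes> inv y \<in> L" if "x \<in> E0" "y \<in> E0" for x y
      using index_p_pow_commutator(2)[OF I(1) E0.subgroup_E I(3) E0.finite_E prime cE0 nrm that]
        \<open>I = L\<close> by simp
  qed

  \<comment> \<open>As g0 is outside E, it moves some coset of \<open>D\<close> in E; y is the
    commutator [x0, g0], which lies in L by \<open>comm_I\<close>.\<close>
  obtain x0 where x0: "x0 \<in> E" "inv x0 \<otimes> cj g0 x0 \<notin> D" using faithful g0 by blast
  define y where "y = inv x0 \<otimes> cj g0 x0"
  have y: "y \<in> L" "y \<notin> D" using comm_I x0 g0 IL by (auto simp: y_def)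
  have g0G: "g0 \<in> carrier G" using g0 by simp
  \<comment> \<open>T D contains y, hence L. If T D were L, then L would be invariant under
    \<open>F E E\<close>, and g0 would stabilize the chain E > L > D and lie in E. So T D = E, and T
    = E by nongeneration.\<close>
  have invariant_eq: "T = E"
    if T: "subgroup T G" "T \<subseteq> E" "y \<in> T" "\<And>\<beta> x. \<beta> \<in> F E E \<Longrightarrow> x \<in> T \<Longrightarrow> \<beta> x \<in> T" for T
  proof -
    let ?TD = "{k \<otimes> d | k d. k \<in> T \<and> d \<in> D}"
    have TD: "subgroup ?TD G" using T by (intro subgroup_mult_D)
    have TDE: "?TD \<subseteq> E" using T(2) by auto
    have DTD: "D \<subseteq> ?TD"
    proof
      fix d assume "d \<in> D"
      then have "d = \<one> \<otimes> d" by simp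
      then show "d \<in> ?TD" using subgroup.one_closed[OF T(1)] \<open>d \<in> D\<close> by blast
    qed
    have "y = y \<otimes> \<one>" using y L_E by simp
    then have yTD: "y \<in> ?TD" using T(3) D_closed(3) by blast
    have "subgroup (?TD \<inter> L) G" using subgroups_Inter_pair TD L by blast
    then have "?TD \<inter> L = D \<or> ?TD \<inter> L = L"
      using subgroup_between_prime_index[OF subgroup_D _ L _ _ finL prime card_L(1)] DTD DL by blast
    then have "L \<subseteq> ?TD" using y yTD by blast
    then have "?TD = L \<or> ?TD = E"
      using subgroup_between_prime_index[OF L TD subgroup_E _ TDE finite_E prime card_L(2)] by blast
    then show "T = E"
    proof
      assume "?TD = E"
      then show ?thesis by (intro nongenerators T) auto
    next
      assume TL: "?TD = L"
      have "\<beta> x \<in> L" if b: "\<beta> \<in> F E E" and x: "x \<in> L" for \<beta> x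
      proof -
        obtain t d where td: "t \<in> T" "d \<in> D" "x = t \<otimes> d" using x TL by blast
        then have "\<beta> x = \<beta> t \<otimes> \<beta> d" using b T(2) by auto
        moreover have "\<beta> t \<in> T" "\<beta> d \<in> D" using T(4) aut_D b td by auto
        ultimately show ?thesis using TL by blast
      qed
      then have "g0 \<in> E"
        using chain_stabilizer_conj_mem[OF L DL LE _ g0G] nE[OF g0(1)] comm_I[OF _ g0(1)] IL
          comm_L[OF _ g0(1)] unfolding cj_def by blast
      then show ?thesis using g0 by simp
    qed
  qed
  let ?T = "{x \<in> E. x [^] p = \<one>}" and ?T2 = "{x \<in> E. (x [^] p) [^] p = \<one>}"
  have yE: "y \<in> E" using y L_E by blast
  have T_inv: "\<beta> x \<in> ?T" if "\<beta> \<in> F E E" "x \<in> ?T" for \<beta> x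
    using that aut_pow[of \<beta> x p, symmetric] by simp
  have T2_inv: "\<beta> x \<in> ?T2" if b: "\<beta> \<in> F E E" and x: "x \<in> ?T2" for \<beta> x
  proof -
    have "(\<beta> x [^] p) [^] p = \<beta> ((x [^] p) [^] p)" using b x aut_pow by simp
    then show ?thesis using b x by simp
  qed
  have T_eq: "?T = E" if "y [^] p = \<one>"
    by (rule invariant_eq[OF subgroup_pow_p]) (use that yE T_inv in auto)
  have T2_eq: "?T2 = E" if "(y [^] p) [^] p = \<one>"
    by (rule invariant_eq[OF subgroup_pow_p2]) (use that yE T2_inv in auto)
  have x0G: "x0 \<in> carrier G" using x0 by simp
  \<comment> \<open>The p-th power map is a homomorphism on E, so [x0, g0]^p = [x0^p, g0].\<close>
  have yp: "y [^] p = inv (x0 [^] p) \<otimes> cj g0 (x0 [^] p)"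
    unfolding y_def using x0(1) cj_E[OF g0(1) x0(1)] g0G
    by (simp add: pow_mult nat_pow_inv cj_pow)
  have zD: "x0 [^] p \<in> D" using x0 by simp
  have "?T = E"
  proof (cases "\<forall>d\<in>D. cj g0 d = d")
    case True
    then have "y [^] p = \<one>" using yp zD x0 by simp
    then show ?thesis by (rule T_eq)
  next
    case False
    let ?D0 = "pfrat G p E0"
    have D0_fixed: "cj g0 d = d" if "d \<in> ?D0" for d
    proof -
      have "cj g0 d = inv g0 \<otimes> (d \<otimes> g0)" using that g0G by (simp add: cj_def m_assoc)
      also have "\<dots> = inv g0 \<otimes> (g0 \<otimes> d)" using E0.central that g0(1) by simp
      also have "\<dots> = d" using that g0G by (simp flip: m_assoc)
      finally show ?thesis .
    qed
    \<comment> \<open>g0 centralizes \<open>?D0\<close> but, in this case, not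
      \<open>D\<close>.\<close>
    then have "?D0 \<noteq> D" using False by auto
    let ?z = "x0 [^] p"
    \<comment> \<open>D \<le> L = I \<le> \<open>E0\<close>, so the p-th power of \<open>?z\<close>
      is a p-th power of an element of \<open>E0\<close>; it lies in \<open>?D0\<close>, which g0
      centralizes.\<close>
    have "?z \<in> E0" using zD DL \<open>I = L\<close> I(3) by blast
    then have zp: "cj g0 (?z [^] p) = ?z [^] p" using D0_fixed by simp
    have "(y [^] p) [^] p = inv (?z [^] p) \<otimes> cj g0 (?z [^] p)"
      unfolding yp using zD cj_D[OF g0(1) zD] g0G by (simp add: pow_mult nat_pow_inv cj_pow)
    then have "(y [^] p) [^] p = \<one>" unfolding zp using x0 by simp
    then have "?T2 = E" by (rule T2_eq)
    then have Dp: "d [^] p = \<one>" if "d \<in> D" for d using D_pow_p[OF _ that] by blast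
    then have D0p: "d [^] p = \<one>" if "d \<in> ?D0" for d using exp_D0 that by blast
    let ?M = "{k \<otimes> d | k d. k \<in> ?D0 \<and> d \<in> D}"
    have D0E: "?D0 \<subseteq> E" using D0L LE by blast
    have M: "subgroup ?M G" by (rule subgroup_mult_D[OF E0.subgroup_D D0E])
    have "D \<subseteq> ?M"
    proof
      fix d assume "d \<in> D"
      then have "d = \<one> \<otimes> d" by simp
      then show "d \<in> ?M" using E0.D_closed(3) \<open>d \<in> D\<close> by blast
    qed
    moreover have "?M \<subseteq> L" using D0L DL subgroup.m_closed[OF L] by blast
    ultimately have "?M = D \<or> ?M = L"
      using subgroup_between_prime_index[OF subgroup_D M L _ _ finL prime card_L(1)] by blast
    \<comment> \<open>\<open>?D0\<close> and \<open>D\<close> are distinct of equal order, so their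
      product is larger than \<open>D\<close>.\<close>
    moreover have "?M \<noteq> D"
    proof
      assume "?M = D"
      have "?D0 \<subseteq> ?M"
      proof
        fix d assume d: "d \<in> ?D0"
        then have "d = d \<otimes> \<one>" by simp
        then show "d \<in> ?M" using d D_closed(3) by blast
      qed
      then have "?D0 \<subseteq> D" using \<open>?M = D\<close> by simp
      moreover have "finite D" using finite_subset[OF DL finL] .
      ultimately have "?D0 = D" using card_D0 by (intro card_subset_eq)
      then show False using \<open>?D0 \<noteq> D\<close> by simp
    qed
    \<comment> \<open>L is now the product of two subgroups of exponent p inside E, so
      \<open>pow_mult\<close> gives y^p = 1.\<close>
    ultimately have "y \<in> ?M" using y by simp
    then obtain k d where kd: "y = k \<otimes> d" "k \<in> ?D0" "d \<in> D" by blast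
    then have "y [^] p = k [^] p \<otimes> d [^] p" using D0E by (auto intro!: pow_mult)
    then have "y [^] p = \<one>" using D0p Dp kd by simp
    then show ?thesis by (rule T_eq)
  qed
  then show ?thesis using x by blast
qed

end

section \<open>Rank, normalizers and the proof of the theorem\<close>

lemma (in group) grp_rank_two:
  assumes "grp_rank G E = 2" "subgroup E G" "finite E"
  obtains a b where "a \<in> E" "b \<in> E" "generate G {a, b} = E"
    and "\<And>e. e \<in> E \<Longrightarrow> generate G {e} \<noteq> E"
proof -
  let ?P = "\<lambda>n. \<exists>A. A \<subseteq> E \<and> finite A \<and> card A = n \<and> generate G A = E"
  \<comment> \<open>E generates itself, so generating sets exist and the least size is
    attained.\<close>
  have "generate G E = E"
    using generate_subgroup_incl[OF subset_refl assms(2)] by (auto intro: generate.incl)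
  then have "?P (card E)" using assms(3) by blast
  then have "?P (LEAST n. ?P n)" by (rule LeastI)
  then have "?P 2" using assms(1) unfolding grp_rank_def by (simp only:)
  then obtain A where A: "A \<subseteq> E" "card A = 2" "generate G A = E" by blast
  then obtain a b where ab: "A = {a, b}" by (meson card_2_iff)
  have "generate G {e} \<noteq> E" if "e \<in> E" for e
  proof
    assume "generate G {e} = E"
    then have "?P 1" using that by (intro exI[of _ "{e}"]) auto
    then have "grp_rank G E \<le> 1" unfolding grp_rank_def by (rule Least_le)
    then show False using assms(1) by simp
  qed
  then show ?thesis using that A ab by blast
qed

lemma (in group) mem_normalizer_iff:
  assumes "E \<subseteq> carrier G"
  shows "g \<in> normalizer G E \<longleftrightarrow> g \<in> carrier G \<and> (\<lambda>x. g \<otimes> x \<otimes> inv g) ` E = E"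
proof -
  have "g <# E #> inv g = (\<lambda>x. g \<otimes> x \<otimes> inv g) ` E" by (auto simp: l_coset_def r_coset_def)
  then show ?thesis using assms by (simp add: normalizer_def stabilizer_def)
qed

lemma (in group) subgroup_normalizer:
  assumes "E \<subseteq> carrier G"
  shows "subgroup (normalizer G E) G"
  unfolding normalizer_def
  by (rule group_action.stabilizer_subgroup[OF action_by_conjugation_on_power_set]) (use assms in simp)

lemma (in group) subgroup_le_normalizer:
  assumes "subgroup E G"
  shows "E \<subseteq> normalizer G E"
proof
  fix g assume g: "g \<in> E"
  have EG: "E \<subseteq> carrier G" using assms subgroup.subset by blast
  have "y \<in> (\<lambda>x. g \<otimes> x \<otimes> inv g) ` E" if "y \<in> E" for y
  proof -
    have "g \<in> carrier G" "y \<in> carrier G" using that g EG by auto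
    then have "y = g \<otimes> (inv g \<otimes> y \<otimes> g) \<otimes> inv g" by (simp flip: m_assoc) (simp add: m_assoc)
    moreover have "inv g \<otimes> y \<otimes> g \<in> E" using that g assms by (simp add: subgroup.m_closed subgroup.m_inv_closed)
    ultimately show ?thesis by blast
  qed
  moreover have "(\<lambda>x. g \<otimes> x \<otimes> inv g) ` E \<subseteq> E"
    using g assms by (auto simp: subgroup.m_closed subgroup.m_inv_closed)
  ultimately have "(\<lambda>x. g \<otimes> x \<otimes> inv g) ` E = E" by blast
  then show "g \<in> normalizer G E" using mem_normalizer_iff[OF EG] g EG by blast
qed

lemma (in group) normalizer_conj_closed:
  assumes "E \<subseteq> carrier G" "g \<in> normalizer G E" "x \<in> E"
  shows "inv g \<otimes> x \<otimes> g \<in> E"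
proof -
  have g: "g \<in> carrier G" "(\<lambda>x. g \<otimes> x \<otimes> inv g) ` E = E"
    using assms mem_normalizer_iff by blast+
  then obtain y where y: "y \<in> E" "x = g \<otimes> y \<otimes> inv g" using assms(3) by blast
  then have "inv g \<otimes> x \<otimes> g = y"
    using g(1) assms(1) by (simp add: m_assoc subset_iff) (simp add: subset_iff flip: m_assoc)
  then show ?thesis using y by simp
qed

theorem theorem1p12:
  fixes G :: "('a,'b) monoid_scheme" and p :: nat
    and F :: "'a set \<Rightarrow> 'a set \<Rightarrow> ('a \<Rightarrow> 'a) set" and E :: "'a set"
  assumes "group G" and "finite (carrier G)" and "prime p" and "odd p"
    and "\<exists>n. card (carrier G) = p ^ n"
    and "saturated G p F"
    and "essential G p F E"
    and "grp_rank G E = 2"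
    and "\<not> fchar F E (normalizer G E)"
    and "frattini G E \<subseteq> center_of G E"
  shows "pearl G p F E"
proof -
  interpret group G by (rule assms(1))
  have fusion: "fusion_system G F" using assms(6) by (simp add: saturated_def)
  have E: "subgroup E G" using assms(7) by (simp add: essential_def)
  then have EG: "E \<subseteq> carrier G" by (rule subgroup.subset)
  obtain m where "card (carrier G) = p ^ m" using assms(5) by blast
  then obtain n where n: "card E = p ^ n"
    using p_group_subgroup_card[OF assms(1,3) E subgroup_self EG] by blast
  have "pfrat G p E \<subseteq> center_of G E"
    using pfrat_le_frattini[OF assms(3) E n] assms(10) by blast
  then have "frattini_central_axioms G p E"
    using assms(3,4) E n by (intro frattini_central_axioms.intro) (auto simp: center_of_def)
  then have FC: "frattini_central G p E" by (simp add: frattini_central_def assms(1))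
  interpret essential_frattini_central G p E F
    using FC assms(7) fusion by (simp add: essential_frattini_central_def essential_frattini_central_axioms_def)
  obtain a b where ab: "a \<in> E" "b \<in> E" "generate G {a, b} = E"
    and noncyclic: "\<And>e. e \<in> E \<Longrightarrow> generate G {e} \<noteq> E"
    using grp_rank_two[OF assms(8) E finite_E] by blast
  let ?N = "normalizer G E"
  have N: "subgroup ?N G" by (rule subgroup_normalizer[OF EG])
  have NG: "?N \<subseteq> carrier G" using N by (rule subgroup.subset)
  have EN: "E \<subseteq> ?N" by (rule subgroup_le_normalizer[OF E])
  obtain \<alpha> where \<alpha>: "\<alpha> \<in> F ?N ?N" "\<alpha> ` E \<noteq> E" using assms(9) by (auto simp: fchar_def)
  have "inj_hom G ?N ?N \<alpha>" using fusion N \<alpha>(1) unfolding fusion_system_def by blast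
  then have \<alpha>_closed: "\<alpha> x \<in> ?N" and \<alpha>_mult: "\<alpha> (x \<otimes>\<^bsub>G\<^esub> y) = \<alpha> x \<otimes>\<^bsub>G\<^esub> \<alpha> y"
    if "x \<in> ?N" "y \<in> ?N" for x y
    using that by (auto simp: inj_hom_def hom_def)
  have \<alpha>_inj: "inj_on \<alpha> ?N" using \<open>inj_hom G ?N ?N \<alpha>\<close> by (simp add: inj_hom_def)
  \<comment> \<open>Surjectivity is needed to write elements of E as images of elements of
    N_S(E).\<close>
  have \<alpha>_surj: "\<alpha> ` ?N = ?N"
    using \<alpha>_closed card_image[OF \<alpha>_inj] finite_subset[OF NG assms(2)]
    by (intro card_subset_eq) auto
  have \<alpha>_hom: "\<alpha> \<in> hom (G\<lparr>carrier := E\<rparr>) G"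
    using \<alpha>_closed \<alpha>_mult EN NG by (intro homI) (auto simp: subset_iff)
  interpret \<alpha>: group_hom "G\<lparr>carrier := E\<rparr>" G \<alpha>
    using \<alpha>_hom subgroup_imp_group[OF E] by (simp add: group_hom_def group_hom_axioms_def)
  have \<alpha>_inv: "\<alpha> (inv\<^bsub>G\<^esub> x) = inv\<^bsub>G\<^esub> (\<alpha> x)" if "x \<in> ?N" for x
  proof -
    have "\<alpha> (inv\<^bsub>G\<^esub> x) \<otimes>\<^bsub>G\<^esub> \<alpha> x = \<alpha> \<one>\<^bsub>G\<^esub>"
      using that N NG \<alpha>_mult[of "inv\<^bsub>G\<^esub> x" x] by (simp add: subgroup.m_inv_closed subset_iff)
    moreover have "\<alpha> \<one>\<^bsub>G\<^esub> = \<one>\<^bsub>G\<^esub>" using \<alpha>.hom_one by simp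
    ultimately show ?thesis
      using that \<alpha>_closed N NG by (intro inv_equality[symmetric]) (auto simp: subgroup.m_inv_closed)
  qed
  have \<alpha>_pow: "\<alpha> (x [^]\<^bsub>G\<^esub> k) = \<alpha> x [^]\<^bsub>G\<^esub> k" if "x \<in> E" for x and k :: nat
    using \<alpha>.hom_nat_pow[of x k] that by (simp flip: nat_pow_consistent)
  let ?E0 = "\<alpha> ` E"
  have E0: "subgroup ?E0 G" using \<alpha>.subgroup_img_is_subgroup[of E] E \<alpha>.G.subgroup_self by simp
  \<comment> \<open>Centrality, order and exponent of \<open>D\<close> carry over to its counterpart
    in \<open>?E0\<close> through \<alpha>.\<close>
  have D0: "pfrat G p ?E0 = \<alpha> ` D" using pfrat_image[OF E \<alpha>_hom] by simp
  have inj_E: "inj_on \<alpha> E" using \<alpha>_inj EN inj_on_subset by blast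
  have DE: "D \<subseteq> E" using pfrat_subset[OF E] .
  have "card ?E0 = card E" using card_image[OF inj_E] .
  have "frattini_central_axioms G p ?E0"
  proof (rule frattini_central_axioms.intro)
    show "\<exists>n. card ?E0 = p ^ n" using \<open>card ?E0 = card E\<close> n by (intro exI[of _ n]) simp
    fix d x assume "d \<in> pfrat G p ?E0" "x \<in> ?E0"
    then obtain e y where ey: "e \<in> D" "y \<in> E" "d = \<alpha> e" "x = \<alpha> y" using D0 by auto
    have "\<alpha> (e \<otimes>\<^bsub>G\<^esub> y) = \<alpha> (y \<otimes>\<^bsub>G\<^esub> e)" using central[OF ey(1,2)] by (rule arg_cong)
    then show "d \<otimes>\<^bsub>G\<^esub> x = x \<otimes>\<^bsub>G\<^esub> d" using ey \<alpha>_mult EN DE by (simp add: subset_iff)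
  qed (use assms(3,4) E0 in auto)
  then have FC0: "frattini_central G p ?E0" by (simp add: frattini_central_def assms(1))
  have E0N: "?E0 \<subseteq> ?N" using \<alpha>_closed EN by blast
  have exp: "x [^]\<^bsub>G\<^esub> p = \<one>\<^bsub>G\<^esub>" if "x \<in> E" for x
  proof (rule exponent_p_if_other_normal[OF FC0 \<open>card ?E0 = card E\<close> \<alpha>(2)])
    show "inv\<^bsub>G\<^esub> g \<otimes>\<^bsub>G\<^esub> x \<otimes>\<^bsub>G\<^esub> g \<in> E" if "g \<in> ?E0" "x \<in> E" for g x
      using normalizer_conj_closed[OF EG] that E0N by blast
    \<comment> \<open>Here g is the image of some h normalizing E, so conjugation by g on
      \<open>?E0\<close> is the image under \<alpha> of conjugation by h on E.\<close>
    show "inv\<^bsub>G\<^esub> g \<otimes>\<^bsub>G\<^esub> x \<otimes>\<^bsub>G\<^esub> g \<in> ?E0" if gx: "g \<in> E" "x \<in> ?E0" for g x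
    proof -
      obtain h where h: "h \<in> ?N" "g = \<alpha> h" using gx(1) EN \<alpha>_surj by blast
      obtain e where e: "e \<in> E" "x = \<alpha> e" using gx(2) by blast
      have "e \<in> ?N" "inv\<^bsub>G\<^esub> h \<in> ?N" "inv\<^bsub>G\<^esub> h \<otimes>\<^bsub>G\<^esub> e \<in> ?N"
        using e EN h N by (auto simp: subgroup.m_closed subgroup.m_inv_closed)
      then have "inv\<^bsub>G\<^esub> g \<otimes>\<^bsub>G\<^esub> x \<otimes>\<^bsub>G\<^esub> g = \<alpha> (inv\<^bsub>G\<^esub> h \<otimes>\<^bsub>G\<^esub> e \<otimes>\<^bsub>G\<^esub> h)"
        using h e by (simp add: \<alpha>_mult \<alpha>_inv)
      then show ?thesis using normalizer_conj_closed[OF EG h(1) e(1)] by simp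
    qed
    show "card E = p * p * card D" by (rule card_eq_two_generated[OF ab noncyclic])
    show "card (pfrat G p ?E0) = card D"
      unfolding D0 by (rule card_image) (use inj_E DE inj_on_subset in blast)
    show "x [^]\<^bsub>G\<^esub> p = \<one>\<^bsub>G\<^esub>" if exp_D: "\<And>d. d \<in> D \<Longrightarrow> d [^]\<^bsub>G\<^esub> p = \<one>\<^bsub>G\<^esub>" "x \<in> pfrat G p ?E0" for x
    proof -
      obtain d where d: "d \<in> D" "x = \<alpha> d" using exp_D(2) D0 by auto
      then have "x [^]\<^bsub>G\<^esub> p = \<alpha> (d [^]\<^bsub>G\<^esub> p)" using \<alpha>_pow[of d p] by simp
      then show ?thesis using exp_D(1)[OF d(1)] \<alpha>.hom_one by simp
    qed
  qed (rule that)
  \<comment> \<open>Commutativity of E decides between the two kinds of pearl; the exponent makes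
    the abelian one elementary.\<close>
  show ?thesis
    using exponent_p_two_generated[OF ab noncyclic exp] assms(7) exp
    by (auto simp: pearl_def split: if_splits)
qed

end
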